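(* Let $G$ be a Hausdorff feathered strongly topological gyrogroup. Then the following conditions are equivalent: (1) $G$ has a compact resolution swallowing the compact sets of $G$; (2) $G$ has a compact $L$-subgyrogroup $H$ such that the quotient space $G/H$ is a Polish space. Moreover, if (1) holds, then $G$ is Čech-complete.
   Context: A gyrogroup is a nonempty set $G$ with a binary operation $\oplus$ such that: (G1) there is a unique identity element $0\in G$ with $0\oplus a=a=a\oplus 0$ for all $a\in G$; (G2) for each $x\in G$ there is a unique inverse $\ominus x\in G$ with $\ominus x\oplus x=0=x\oplus(\ominus x)$; (G3) for all $x,y\in G$ there is an automorphism $\mathrm{gyr}[x,y]$ of $(G,\oplus)$ with $x\oplus(y\oplus z)=(x\oplus y)\oplus \mathrm{gyr}[x,y](z)$ for all $z\in G$; (G4) $\mathrm{gyr}[x\oplus y,y]=\mathrm{gyr}[x,y]$ for all $x,y\in G$. A topological gyrogroup is a gyrogroup with a topology such that $\oplus:G\times G\to G$ is jointly continuous and $x\mapsto\ominus x$ is continuous. A topological gyrogroup $G$ is a strongly topological gyrogroup if there is a neighborhood base $\mathscr{U}$ of $0$ such that $\mathrm{gyr}[x,y](U)=U$ for every $U\in\mathscr{U}$ and all $x,y\in G$. A topological gyrogroup $G$ is feathered if it contains a nonempty compact set $K$ of countable character in $G$, i.e. there is a countable family of open sets containing $K$ such that every open set containing $K$ contains a member of the family. A subgyrogroup of $G$ is a nonempty subset $H\subseteq G$ that forms a gyrogroup under the operation inherited from $G$ and such that the restriction of $\mathrm{gyr}[a,b]$ to $H$ is an automorphism of $H$ for all $a,b\in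 H$; it is an $L$-subgyrogroup if moreover $\mathrm{gyr}[a,h](H)=H$ for all $a\in G$, $h\in H$. For an $L$-subgyrogroup $H$, the left cosets $x\oplus H$ ($x\in G$) partition $G$, and $G/H=\{x\oplus H:x\in G\}$ carries the quotient topology with respect to $\pi:G\to G/H$, $\pi(x)=x\oplus H$. $\mathbb{N}^{\mathbb{N}}$ is the set of all functions $\mathbb{N}\to\mathbb{N}$ with the partial order $f\le g$ iff $f(n)\le g(n)$ for all $n$. A compact resolution of a space $X$ is a family $\{K_\alpha:\alpha\in\mathbb{N}^{\mathbb{N}}\}$ of compact subsets of $X$ with $X=\bigcup_\alpha K_\alpha$ and $K_\alpha\subseteq K_\beta$ whenever $\alpha\le\beta$; it swallows the compact sets of $X$ if every compact subset of $X$ is contained in some $K_\alpha$. A Polish space is a separable completely metrizable space. All topological spaces are assumed to be Hausdorff. *)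

theory Defs
  imports "HOL-Analysis.Analysis"
begin

text \<open>Algebraic structures are given by a carrier set and operations that are only
  constrained on that carrier.  The map gyr is a parameter; by left cancellation it is uniquely
  determined on the carrier by the operation.\<close>

definition gyro_zero :: "'a set \<Rightarrow> ('a \<Rightarrow> 'a \<Rightarrow> 'a) \<Rightarrow> 'a" where
  "gyro_zero G add = (THE e. e \<in> G \<and> (\<forall>a\<in>G. add e a = a \<and> add a e = a))"

definition gyro_inv :: "'a set \<Rightarrow> ('a \<Rightarrow> 'a \<Rightarrow> 'a) \<Rightarrow> 'a \<Rightarrow> 'a" where
  "gyro_inv G add x =
     (THE y. y \<in> G \<and> add y x = gyro_zero G add \<and> add x y = gyro_zero G add)"

definition gyro_automorphism :: "'a set \<Rightarrow> ('a \<Rightarrow> 'a \<Rightarrow> 'a) \<Rightarrow> ('a \<Rightarrow> 'a) \<Rightarrow> bool" where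
  "gyro_automorphism G add f \<longleftrightarrow>
     bij_betw f G G \<and> (\<forall>x\<in>G. \<forall>y\<in>G. f (add x y) = add (f x) (f y))"

locale gyrogroup =
  fixes G :: "'a set"
    and add :: "'a \<Rightarrow> 'a \<Rightarrow> 'a" (infixl "\<oplus>" 65)
    and gyr :: "'a \<Rightarrow> 'a \<Rightarrow> 'a \<Rightarrow> 'a"
  assumes nonempty: "G \<noteq> {}"
    and closed: "\<And>x y. x \<in> G \<Longrightarrow> y \<in> G \<Longrightarrow> x \<oplus> y \<in> G"
    and ex1_identity: "\<exists>!e. e \<in> G \<and> (\<forall>a\<in>G. e \<oplus> a = a \<and> a \<oplus> e = a)"
    and ex1_inverse: "\<And>x. x \<in> G \<Longrightarrow>
          \<exists>!y. y \<in> G \<and> y \<oplus> x = gyro_zero G (\<oplus>) \<and> x \<oplus> y = gyro_zero G (\<oplus>)"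
    and gyr_automorphism: "\<And>x y. x \<in> G \<Longrightarrow> y \<in> G \<Longrightarrow> gyro_automorphism G (\<oplus>) (gyr x y)"
    and gyr_assoc: "\<And>x y z. x \<in> G \<Longrightarrow> y \<in> G \<Longrightarrow> z \<in> G \<Longrightarrow>
          x \<oplus> (y \<oplus> z) = (x \<oplus> y) \<oplus> gyr x y z"
    and left_loop: "\<And>x y z. x \<in> G \<Longrightarrow> y \<in> G \<Longrightarrow> z \<in> G \<Longrightarrow> gyr (x \<oplus> y) y z = gyr x y z"

locale topological_gyrogroup = gyrogroup "topspace X" add gyr
  for X :: "'a topology"
    and add :: "'a \<Rightarrow> 'a \<Rightarrow> 'a" (infixl "\<oplus>" 65)
    and gyr :: "'a \<Rightarrow> 'a \<Rightarrow> 'a \<Rightarrow> 'a" +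
  assumes continuous_add: "continuous_map (prod_topology X X) X (\<lambda>(x, y). x \<oplus> y)"
    and continuous_inv: "continuous_map X X (gyro_inv (topspace X) (\<oplus>))"

text \<open>The members of the neighbourhood base need not be open.\<close>

locale strongly_topological_gyrogroup = topological_gyrogroup X add gyr
  for X :: "'a topology"
    and add :: "'a \<Rightarrow> 'a \<Rightarrow> 'a" (infixl "\<oplus>" 65)
    and gyr :: "'a \<Rightarrow> 'a \<Rightarrow> 'a \<Rightarrow> 'a" +
  assumes gyr_invariant_base:
    "\<exists>\<U>. (\<forall>U\<in>\<U>. U \<subseteq> topspace X \<and>
              (\<exists>V. openin X V \<and> gyro_zero (topspace X) (\<oplus>) \<in> V \<and> V \<subseteq> U)) \<and>
         (\<forall>W. openin X W \<and> gyro_zero (topspace X) (\<oplus>) \<in> W \<longrightarrow> (\<exists>U\<in>\<U>. U \<subseteq> W)) \<and>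
         (\<forall>U\<in>\<U>. \<forall>x\<in>topspace X. \<forall>y\<in>topspace X. gyr x y ` U = U)"

definition countable_character_in :: "'a topology \<Rightarrow> 'a set \<Rightarrow> bool" where
  "countable_character_in X K \<longleftrightarrow>
     (\<exists>\<V>. countable \<V> \<and> (\<forall>V\<in>\<V>. openin X V \<and> K \<subseteq> V) \<and>
          (\<forall>W. openin X W \<and> K \<subseteq> W \<longrightarrow> (\<exists>V\<in>\<V>. V \<subseteq> W)))"

definition feathered :: "'a topology \<Rightarrow> bool" where
  "feathered X \<longleftrightarrow> (\<exists>K. K \<noteq> {} \<and> compactin X K \<and> countable_character_in X K)"

text \<open>A subset that is a gyrogroup under the inherited operation has some gyr map of its own;
  the second condition concerns the gyr map of the ambient gyrogroup.\<close>

definition subgyrogroup ::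
  "'a set \<Rightarrow> ('a \<Rightarrow> 'a \<Rightarrow> 'a) \<Rightarrow> ('a \<Rightarrow> 'a \<Rightarrow> 'a \<Rightarrow> 'a) \<Rightarrow> 'a set \<Rightarrow> bool" where
  "subgyrogroup G add gyr H \<longleftrightarrow>
     H \<noteq> {} \<and> H \<subseteq> G \<and> (\<exists>gyr'. gyrogroup H add gyr') \<and>
     (\<forall>a\<in>H. \<forall>b\<in>H. gyro_automorphism H add (gyr a b))"

definition L_subgyrogroup ::
  "'a set \<Rightarrow> ('a \<Rightarrow> 'a \<Rightarrow> 'a) \<Rightarrow> ('a \<Rightarrow> 'a \<Rightarrow> 'a \<Rightarrow> 'a) \<Rightarrow> 'a set \<Rightarrow> bool" where
  "L_subgyrogroup G add gyr H \<longleftrightarrow>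
     subgyrogroup G add gyr H \<and> (\<forall>a\<in>G. \<forall>h\<in>H. gyr a h ` H = H)"

definition left_coset :: "('a \<Rightarrow> 'a \<Rightarrow> 'a) \<Rightarrow> 'a set \<Rightarrow> 'a \<Rightarrow> 'a set" where
  "left_coset add H x = add x ` H"

definition coset_space :: "'a topology \<Rightarrow> ('a \<Rightarrow> 'a \<Rightarrow> 'a) \<Rightarrow> 'a set \<Rightarrow> 'a set topology" where
  "coset_space X add H =
     topology (\<lambda>\<W>. \<W> \<subseteq> left_coset add H ` topspace X \<and>
                    openin X {x \<in> topspace X. left_coset add H x \<in> \<W>})"

lemma openin_coset_space:
  "openin (coset_space X add H) \<W> \<longleftrightarrow>
     \<W> \<subseteq> left_coset add H ` topspace X \<and>
     openin X {x \<in> topspace X. left_coset add H x \<in> \<W>}"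
proof -
  let ?P = "\<lambda>\<W>. \<W> \<subseteq> left_coset add H ` topspace X \<and>
                  openin X {x \<in> topspace X. left_coset add H x \<in> \<W>}"
  have "istopology ?P"
    unfolding istopology_def
  proof (intro conjI allI impI)
    fix S T assume S: "?P S" and T: "?P T"
    show "S \<inter> T \<subseteq> left_coset add H ` topspace X"
      using S by blast
    have "{x \<in> topspace X. left_coset add H x \<in> S \<inter> T} =
          {x \<in> topspace X. left_coset add H x \<in> S} \<inter> {x \<in> topspace X. left_coset add H x \<in> T}"
      by blast
    then show "openin X {x \<in> topspace X. left_coset add H x \<in> S \<inter> T}"
      using S T by (simp add: openin_Int)
  next
    fix \<K> assume \<K>: "\<forall>K\<in>\<K>. ?P K"
    show "\<Union>\<K> \<subseteq> left_coset add H ` topspace X"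
      using \<K> by blast
    have "{x \<in> topspace X. left_coset add H x \<in> \<Union>\<K>} =
          \<Union>((\<lambda>K. {x \<in> topspace X. left_coset add H x \<in> K}) ` \<K>)"
      by blast
    then show "openin X {x \<in> topspace X. left_coset add H x \<in> \<Union>\<K>}"
      using \<K> by auto
  qed
  then show ?thesis
    unfolding coset_space_def by (simp add: topology_inverse')
qed

lemma topspace_coset_space:
  "topspace (coset_space X add H) = left_coset add H ` topspace X"
proof
  show "topspace (coset_space X add H) \<subseteq> left_coset add H ` topspace X"
    using openin_coset_space[of X add H] by (metis openin_topspace)
  have "openin (coset_space X add H) (left_coset add H ` topspace X)"
    unfolding openin_coset_space by (auto intro: openin_subopen[THEN iffD2])
  then show "left_coset add H ` topspace X \<subseteq> topspace (coset_space X add H)"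
    by (rule openin_subset)
qed

lemma quotient_map_coset_space:
  "quotient_map X (coset_space X add H) (left_coset add H)"
  unfolding quotient_map_def topspace_coset_space openin_coset_space by blast

definition Polish_space :: "'a topology \<Rightarrow> bool" where
  "Polish_space X \<longleftrightarrow> separable_space X \<and> completely_metrizable_space X"

text \<open>The order on \<^typ>\<open>nat \<Rightarrow> nat\<close> is the pointwise one.\<close>

definition compact_resolution :: "'a topology \<Rightarrow> ((nat \<Rightarrow> nat) \<Rightarrow> 'a set) \<Rightarrow> bool" where
  "compact_resolution X K \<longleftrightarrow>
     (\<forall>\<alpha>. compactin X (K \<alpha>)) \<and> topspace X = (\<Union>\<alpha>. K \<alpha>) \<and>
     (\<forall>\<alpha> \<beta>. \<alpha> \<le> \<beta> \<longrightarrow> K \<alpha> \<subseteq> K \<beta>)"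

definition swallows_compact_sets :: "'a topology \<Rightarrow> ((nat \<Rightarrow> nat) \<Rightarrow> 'a set) \<Rightarrow> bool" where
  "swallows_compact_sets X K \<longleftrightarrow> (\<forall>C. compactin X C \<longrightarrow> (\<exists>\<alpha>. C \<subseteq> K \<alpha>))"

text \<open>The Stone--Cech compactification is the closure of the image of the space in the cube
  indexed by its continuous functions into the unit interval.  Functions that agree on the space
  index equal coordinates there, hence also on the closure.  A space is Cech-complete if it is
  Tychonoff and a G-delta set in its Stone--Cech compactification.\<close>

definition unit_interval_maps :: "'a topology \<Rightarrow> ('a \<Rightarrow> real) set" where
  "unit_interval_maps X = {f. continuous_map X (top_of_set {0..1}) f}"

definition stone_cech_embedding :: "'a topology \<Rightarrow> 'a \<Rightarrow> (('a \<Rightarrow> real) \<Rightarrow> real)" where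
  "stone_cech_embedding X x = (\<lambda>f\<in>unit_interval_maps X. f x)"

definition stone_cech :: "'a topology \<Rightarrow> (('a \<Rightarrow> real) \<Rightarrow> real) topology" where
  "stone_cech X =
     (let Q = product_topology (\<lambda>_. top_of_set {0..1}) (unit_interval_maps X)
      in subtopology Q (Q closure_of (stone_cech_embedding X ` topspace X)))"

definition Cech_complete_space :: "'a topology \<Rightarrow> bool" where
  "Cech_complete_space X \<longleftrightarrow>
     completely_regular_space X \<and> Hausdorff_space X \<and>
     gdelta_in (stone_cech X) (stone_cech_embedding X ` topspace X)"

end

theory Submission
  imports Defs
begin

text \<open>The sets \<open>{(x, y). \<ominus>x \<oplus> y \<in> U}\<close>, for U a symmetric gyr-invariant neighbourhood of 0,
  compose like the left uniformity of a group.  Hence a sequence of such neighbourhoods shrinking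
  fast enough inside a countable base of a compact set K containing 0 yields a continuous
  pseudometric whose zero set H at 0 is a compact L-subgyrogroup; moreover these neighbourhoods
  are a base at H, so the pseudometric metrizes G/H.  The projection onto the quotient by a compact
  L-subgyrogroup is a proper map, so compact resolutions swallowing compact sets can be pushed
  forward and pulled back along it.  By Christensen's theorem a metrizable space with such a
  resolution is Polish, and a preimage of a completely metrizable space under a proper map is
  Cech-complete.\<close>

section \<open>Pseudometrics from sequences of entourages\<close>

text \<open>Non-associativity does no harm because \<open>\<ominus> x \<oplus> z = (\<ominus> x
  \<oplus> y) \<oplus> gyr (\<ominus> x) y (\<ominus> y \<oplus> z)\<close>: a neighbourhood that
  every gyration maps onto itself contains the gyrated summand exactly when it contains
  \<open>\<ominus> y \<oplus> z\<close>. Sums of three terms occur because a chain is cut into two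
  light pieces and one middle link that may be heavy. The inclusion of H in K, which rests on the
  Hausdorff property, makes H compact; compactness of H makes the projection closed with compact
  fibres. Featheredness yields no more than a metrizable quotient: the additive group of rationals
  is feathered but not completely metrizable. So completeness has to come from the resolution, by
  showing that the quotient is a G-delta set in its completion. In the converse direction and for
  Cech-completeness the subgyrogroup enters only through the properness of its projection, so any H
  as in (2) will do.\<close>

lemma sum_lessThan_add:
  fixes g :: "nat \<Rightarrow> 'a::comm_monoid_add"
  shows "(\<Sum>i<m + n. g i) = (\<Sum>i<m. g i) + (\<Sum>i<n. g (m + i))"
  by (induction n) (auto simp: add.assoc)

text \<open>Frink's chain lemma: induction on the length, cutting the chain near half of its total
  weight.\<close>

lemma chain_bound:
  fixes f :: "'a \<Rightarrow> 'a \<Rightarrow> real"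
  assumes nonneg: "\<And>x y. 0 \<le> f x y" and refl: "\<And>x. f x x = 0"
    and three: "\<And>w x y z m. \<lbrakk>f w x \<le> m; f x y \<le> m; f y z \<le> m\<rbrakk> \<Longrightarrow> f w z \<le> 2 * m"
  shows "f (s 0) (s n) \<le> 2 * (\<Sum>i<n. f (s i) (s (Suc i)))"
proof (induction n arbitrary: s rule: less_induct)
  case (less n)
  define a where "a = (\<Sum>i<n. f (s i) (s (Suc i)))"
  have a0: "0 \<le> a" unfolding a_def by (simp add: nonneg sum_nonneg)
  show ?case
  proof (cases "n = 0")
    case True then show ?thesis by (simp add: refl)
  next
    case False
    \<comment> \<open>The cut is placed after the longest initial piece of weight at most
      \<open>a / 2\<close>. By maximality the piece up to \<open>Suc k\<close> is heavier, which
      leaves at most \<open>a / 2\<close> behind it. The link from \<open>k\<close> to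
      \<open>Suc k\<close> is bounded only by \<open>a\<close>, and so are the two outer distances
      after the induction hypothesis doubles their bounds.\<close>
    define P where "P k \<longleftrightarrow> k < n \<and> (\<Sum>i<k. f (s i) (s (Suc i))) \<le> a / 2" for k
    have "P 0" using False a0 by (simp add: P_def)
    then obtain k where k: "P k" and kmax: "\<And>j. P j \<Longrightarrow> j \<le> k"
      using Nat.ex_has_greatest_nat[of P 0 n] by (auto simp: P_def less_imp_le)
    have kn: "k < n" using k by (simp add: P_def)
    have "f (s 0) (s k) \<le> 2 * (\<Sum>i<k. f (s i) (s (Suc i)))"
      using less.IH[OF kn] by blast
    then have 1: "f (s 0) (s k) \<le> a" using k by (simp add: P_def)
    have 2: "f (s k) (s (Suc k)) \<le> a"
      unfolding a_def using kn by (intro member_le_sum) (auto simp: nonneg)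
    define r where "r = n - Suc k"
    have n_eq: "n = Suc k + r" using kn by (simp add: r_def)
    have split: "a = (\<Sum>i<Suc k. f (s i) (s (Suc i))) + (\<Sum>i<r. f (s (Suc k + i)) (s (Suc (Suc k + i))))"
      unfolding a_def n_eq by (simp only: sum_lessThan_add)
    have "(\<Sum>i<r. f (s (Suc k + i)) (s (Suc (Suc k + i)))) \<le> a / 2"
    proof (cases "r = 0")
      case True then show ?thesis using a0 by simp
    next
      case False
      then have "\<not> P (Suc k)" "Suc k < n" using kmax[of "Suc k"] n_eq by auto
      then show ?thesis using split by (simp add: P_def)
    qed
    moreover have "f (s (Suc k + 0)) (s (Suc k + r)) \<le> 2 * (\<Sum>i<r. f (s (Suc k + i)) (s (Suc k + Suc i)))"
      using less.IH[of r "\<lambda>i. s (Suc k + i)"] n_eq by simp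
    ultimately have "f (s (Suc k)) (s n) \<le> a" using n_eq by simp
    from three[OF 1 2 this] show ?thesis by (simp add: a_def)
  qed
qed

text \<open>Frink's metrization argument. The gauge \<open>f\<close> assigns to a pair the infimum
  of the scales at which it is close, and \<open>d\<close> is the infimum of the
  \<open>f\<close>-lengths of chains. The chain lemma gives \<open>f \<le> 2 * d\<close>, and
  one-link chains give \<open>d \<le> f\<close>. The lost factor 2 is offset by the shift of the
  index, so both final estimates carry the same exponent \<open>Suc n\<close>.\<close>

lemma pseudometric_from_entourages:
  fixes E :: "nat \<Rightarrow> 'a \<Rightarrow> 'a \<Rightarrow> bool"
  assumes E_refl: "\<And>n x. E n x x" and E_sym: "\<And>n x y. E n x y \<Longrightarrow> E n y x"
    and E_comp: "\<And>n w x y z. \<lbrakk>E (Suc n) w x; E (Suc n) x y; E (Suc n) y z\<rbrakk> \<Longrightarrow> E n w z"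
  obtains d :: "'a \<Rightarrow> 'a \<Rightarrow> real"
  where "\<And>x y. 0 \<le> d x y" "\<And>x. d x x = 0" "\<And>x y. d x y = d y x"
    "\<And>x y z. d x z \<le> d x y + d y z"
    "\<And>n x y. E n x y \<Longrightarrow> d x y \<le> (1/2) ^ Suc n"
    "\<And>n x y. d x y < (1/2) ^ Suc n \<Longrightarrow> E n x y"
proof -
  \<comment> \<open>The shift makes f below an infimum over a nonempty set.\<close>
  define F where "F n x y \<longleftrightarrow> n = 0 \<or> E (n - 1) x y" for n x y
  have Frefl: "F n x x" for n x by (simp add: F_def E_refl)
  have Fcomp: "F n w z" if "F (Suc n) w x" "F (Suc n) x y" "F (Suc n) y z" for n w x y z
    using that E_comp[of "n - 1" w x y z] by (cases n) (auto simp: F_def)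
  have Fmono: "F n x y" if "F m x y" "n \<le> m" for n m x y
    using that(2,1) by (induction rule: inc_induct) (auto intro: Fcomp Frefl)
  define f :: "'a \<Rightarrow> 'a \<Rightarrow> real" where "f x y = Inf {(1/2) ^ n |n. F n x y}" for x y
  have bdd: "bdd_below {(1/2::real) ^ n |n. F n x y}" for x y
    by (rule bdd_belowI[of _ "0::real"]) auto
  have ne: "{(1/2) ^ n |n. F n x y} \<noteq> ({} :: real set)" for x y
    by (auto simp: F_def)
  have f_le: "f x y \<le> (1/2) ^ n" if "F n x y" for n x y
    unfolding f_def by (rule cInf_lower[OF _ bdd]) (use that in auto)
  have f_less: "F (Suc n) x y" if lt: "f x y < (1/2) ^ n" for n x y
  proof -
    obtain m where m: "F m x y" "(1/2::real) ^ m < (1/2) ^ n"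
      using cInf_lessD[OF ne lt[unfolded f_def]] by blast
    then have "n < m" by (simp add: power_strict_decreasing_iff)
    with m show ?thesis using Fmono[of m x y "Suc n"] by simp
  qed
  have f0: "0 \<le> f x y" for x y
    unfolding f_def by (rule cInf_greatest[OF ne]) auto
  have small: "f x y = 0" if "\<And>n. F n x y" for x y
  proof (rule ccontr)
    assume "f x y \<noteq> 0"
    then obtain n where "(1/2) ^ n < f x y"
      using f0[of x y] real_arch_pow_inv[of "f x y" "1/2"] by auto
    then show False using f_le[OF that[of n]] by simp
  qed
  have frefl: "f x x = 0" for x using small Frefl by blast
  have Fsym: "F n x y \<longleftrightarrow> F n y x" for n x y
    unfolding F_def using E_sym by blast
  have fsym: "f x y = f y x" for x y
    unfolding f_def by (simp add: Fsym[of _ x y])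
  have three: "f w z \<le> 2 * m" if "f w x \<le> m" "f x y \<le> m" "f y z \<le> m" for w x y z m
  proof (rule ccontr)
    assume "\<not> f w z \<le> 2 * m"
    then have lt: "2 * m < f w z" by simp
    have m0: "0 \<le> m" using f0[of w x] that by linarith
    have step: "F n w z" for n
    proof (cases "m < (1/2) ^ n")
      case True
      then have "F (Suc n) w z'" if "f w z' \<le> m" for w z' using f_less that by fastforce
      then show ?thesis using Fcomp that by blast
    next
      case False
      \<comment> \<open>At the first scale \<open>N\<close> with \<open>(1/2) ^ N \<le> m\<close>,
        the previous scale is still larger than \<open>m\<close>, so all three pairs are close at
        level \<open>N\<close>. Then \<open>w\<close> and \<open>z\<close> are close at level
        \<open>N - 1\<close>, and
        \<open>(1/2) ^ (N - 1) = 2 * (1/2) ^ N \<le> 2 * m\<close>.\<close>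
      define N where "N = (LEAST n. \<not> m < (1/2) ^ n)"
      have N: "\<not> m < (1/2) ^ N" unfolding N_def by (rule LeastI[of _ n]) (use False in simp)
      show ?thesis
      proof (cases N)
        case 0
        have "f w z \<le> 1" using f_le[of 0 w z] by (simp add: F_def)
        then show ?thesis using N 0 lt by simp
      next
        case (Suc k)
        then have "m < (1/2) ^ k" using not_less_Least[of k "\<lambda>n. \<not> m < (1/2) ^ n"] by (auto simp flip: N_def)
        then have "F (Suc k) a b" if "f a b \<le> m" for a b using f_less that by fastforce
        then have "F k w z" using Fcomp that by blast
        then have "f w z \<le> (1/2) ^ k" by (rule f_le)
        then show ?thesis using N Suc lt by simp
      qed
    qed
    then show False using small[of w z] lt m0 by simp
  qed
  define C where "C x y = {\<Sum>i<n. f (s i) (s (Suc i)) |s n. s 0 = x \<and> s n = y}" for x y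
  define d where "d x y = Inf (C x y)" for x y
  have chain: "\<exists>s n. c = (\<Sum>i<n. f (s i) (s (Suc i))) \<and> s 0 = x \<and> s n = y" if "c \<in> C x y" for c x y
    using that unfolding C_def by blast
  have chainI: "(\<Sum>i<n. f (s i) (s (Suc i))) \<in> C (s 0) (s n)" for s n
    unfolding C_def by blast
  have fC: "f x y \<in> C x y" for x y
    using chainI[where s = "\<lambda>i. if i = 0 then x else y" and n = 1] by simp
  have Cne: "C x y \<noteq> {}" for x y using fC by blast
  have Cbound: "f x y \<le> 2 * c" if c: "c \<in> C x y" for x y c
  proof -
    obtain s n where "c = (\<Sum>i<n. f (s i) (s (Suc i)))" "s 0 = x" "s n = y"
      using chain[OF c] by blast
    then show ?thesis using chain_bound[of f s n, OF f0 frefl three] by simp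
  qed
  have C0: "0 \<le> c" if "c \<in> C x y" for x y c
    using Cbound[OF that] f0[of x y] by simp
  have Cbdd: "bdd_below (C x y)" for x y by (rule bdd_belowI) (rule C0)
  have d_le: "d x y \<le> f x y" for x y
    unfolding d_def by (rule cInf_lower[OF fC Cbdd])
  have f_le_d: "f x y \<le> 2 * d x y" for x y
  proof -
    have "f x y / 2 \<le> d x y"
      unfolding d_def by (rule cInf_greatest[OF Cne]) (use Cbound in fastforce)
    then show ?thesis by simp
  qed
  have Csym: "C x y \<subseteq> C y x" for x y
  proof
    fix c assume "c \<in> C x y"
    then obtain s n where s: "c = (\<Sum>i<n. f (s i) (s (Suc i)))" "s 0 = x" "s n = y"
      using chain by blast
    have "c = (\<Sum>i<n. f (s (n - Suc i)) (s (Suc (n - Suc i))))"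
      unfolding s(1) by (rule sum.nat_diff_reindex[symmetric])
    also have "\<dots> = (\<Sum>i<n. f (s (n - i)) (s (n - Suc i)))"
      by (intro sum.cong refl) (simp add: fsym Suc_diff_Suc)
    finally show "c \<in> C y x"
      using chainI[of "\<lambda>i. s (n - i)" n] s by simp
  qed
  have Cadd: "c + c' \<in> C x z" if c: "c \<in> C x y" and c': "c' \<in> C y z" for c c' x y z
  proof -
    obtain s n where s: "c = (\<Sum>i<n. f (s i) (s (Suc i)))" "s 0 = x" "s n = y"
      using chain[OF c] by blast
    obtain t m where t: "c' = (\<Sum>i<m. f (t i) (t (Suc i)))" "t 0 = y" "t m = z"
      using chain[OF c'] by blast
    define u where "u i = (if i \<le> n then s i else t (i - n))" for i
    have u2: "u (n + i) = t i" for i using s t by (cases i) (auto simp: u_def)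
    have "(\<Sum>i<n + m. f (u i) (u (Suc i))) =
        (\<Sum>i<n. f (u i) (u (Suc i))) + (\<Sum>i<m. f (u (n + i)) (u (n + Suc i)))"
      by (simp add: sum_lessThan_add)
    also have "\<dots> = c + c'"
      unfolding u2 s(1) t(1) by (simp add: u_def)
    finally show ?thesis
      using chainI[of u "n + m"] u2[of m] s t by (simp add: u_def)
  qed
  show thesis
  proof
    show "0 \<le> d x y" for x y unfolding d_def by (rule cInf_greatest[OF Cne C0])
    show "d x x = 0" for x using d_le[of x x] f_le_d[of x x] by (simp add: frefl)
    show "d x y = d y x" for x y 
      unfolding d_def using Csym[of x y] Csym[of y x] by (simp add: subset_antisym)
    show "d x z \<le> d x y + d y z" for x y z
    proof (rule field_le_epsilon)
      fix e :: real assume "0 < e"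
      obtain c where c: "c \<in> C x y" "c < d x y + e / 2"
        using cInf_lessD[OF Cne[of x y], of "d x y + e / 2"] \<open>0 < e\<close> unfolding d_def by auto
      obtain c' where c': "c' \<in> C y z" "c' < d y z + e / 2"
        using cInf_lessD[OF Cne[of y z], of "d y z + e / 2"] \<open>0 < e\<close> unfolding d_def by auto
      have "d x z \<le> c + c'"
        unfolding d_def by (rule cInf_lower[OF Cadd[OF c(1) c'(1)] Cbdd])
      then show "d x z \<le> d x y + d y z + e" using c c' by simp
    qed
    show "d x y \<le> (1/2) ^ Suc n" if "E n x y" for n x y
      using d_le[of x y] f_le[of "Suc n" x y] that by (simp add: F_def)
    show "E n x y" if "d x y < (1/2) ^ Suc n" for n x y
    proof -
      have "f x y < (1/2) ^ n" using that f_le_d[of x y] by simp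
      then show ?thesis using f_less[of x y n] by (simp add: F_def)
    qed
  qed
qed

section \<open>Compact resolutions\<close>

text \<open>An initial segment of a sequence is stored with its last entry first, so that extending it
  by one entry is a Cons.\<close>

primrec initial_segment :: "(nat \<Rightarrow> nat) \<Rightarrow> nat \<Rightarrow> nat list" where
  "initial_segment \<alpha> 0 = []"
| "initial_segment \<alpha> (Suc n) = \<alpha> n # initial_segment \<alpha> n"

lemma length_initial_segment [simp]: "length (initial_segment \<alpha> n) = n"
  by (induction n) auto

lemma initial_segment_eqD:
  "initial_segment \<alpha> n = initial_segment \<beta> n \<Longrightarrow> i < n \<Longrightarrow> \<alpha> i = \<beta> i"
  by (induction n) (auto simp: less_Suc_eq)

text \<open>At coordinate \<open>k\<close> only the sequences \<open>a n\<close> with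
  \<open>n \<le> k\<close> can differ from \<alpha>, so the \<open>a n\<close> have a finite
  coordinatewise maximum; monotonicity then puts all \<open>x n\<close> into one member of the
  family. This is how a single compact set is obtained from information about initial
  segments.\<close>

lemma resolution_diagonal:
  fixes K :: "(nat \<Rightarrow> nat) \<Rightarrow> 'a set"
  assumes mono: "\<And>\<alpha> \<beta>. \<alpha> \<le> \<beta> \<Longrightarrow> K \<alpha> \<subseteq> K \<beta>"
    and x: "\<And>n. x n \<in> K (a n)"
    and a: "\<And>n. initial_segment (a n) n = initial_segment \<alpha> n"
  obtains \<beta> where "\<And>n. x n \<in> K \<beta>"
proof
  define \<beta> where "\<beta> k = Max (insert (\<alpha> k) ((\<lambda>n. a n k) ` {..k}))" for k
  have "a n \<le> \<beta>" for n
  proof (rule le_funI)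
    fix k
    show "a n k \<le> \<beta> k"
    proof (cases "n \<le> k")
      case True then show ?thesis unfolding \<beta>_def by (intro Max_ge) auto
    next
      case False
      then have "a n k = \<alpha> k" using initial_segment_eqD[OF a[of n], of k] by simp
      then show ?thesis unfolding \<beta>_def by (intro Max_ge) auto
    qed
  qed
  then show "x n \<in> K \<beta>" for n using mono x by blast
qed

text \<open>A scheme of open sets indexed by finite sequences generates a Souslin set in general.
  When every branching can be continued greedily at each point of Y, the sets on which the greedy
  branch starts with s are differences of open sets, and the complement of Y consists of the
  points where the greedy branch gets stuck; hence it is an F-sigma set.\<close>

primrec greedy_part :: "'a set \<Rightarrow> (nat list \<Rightarrow> 'a set) \<Rightarrow> nat list \<Rightarrow> 'a set" where
  "greedy_part S W [] = S"
| "greedy_part S W (i # s) = greedy_part S W s \<inter> W (i # s) - (\<Union>j<i. W (j # s))"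

lemma gdelta_in_greedy:
  assumes Z: "metrizable_space Z" and W: "\<And>s. openin Z (W s)"
    and W_Nil: "W [] = topspace Z" and Y: "Y \<subseteq> topspace Z"
    and step: "\<And>x s. \<lbrakk>x \<in> Y; x \<in> W s\<rbrakk> \<Longrightarrow> \<exists>i. x \<in> W (i # s)"
    and branch: "\<And>p \<alpha>. \<lbrakk>p \<in> topspace Z; \<And>n. p \<in> W (initial_segment \<alpha> n)\<rbrakk> \<Longrightarrow> p \<in> Y"
  shows "gdelta_in Z Y"
proof -
  let ?D = "greedy_part (topspace Z) W"
  have "fsigma_in Z (?D s)" for s
  proof (induction s)
    case (Cons i s)
    have "gdelta_in Z (\<Union>j<i. W (j # s))" using W by (intro open_imp_gdelta_in) auto
    then show ?case
      unfolding greedy_part.simps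
      by (intro fsigma_in_diff fsigma_in_Int Cons open_imp_fsigma_in[OF Z W])
  qed simp
  then have fs: "fsigma_in Z (?D s - (\<Union>i. W (i # s)))" for s
    using W by (intro fsigma_in_diff open_imp_gdelta_in) auto
  have DW: "?D s \<subseteq> W s" for s by (cases s) (auto simp: W_Nil)
  have "topspace Z - Y = (\<Union>s. ?D s - (\<Union>i. W (i # s)))"
  proof
    show "(\<Union>s. ?D s - (\<Union>i. W (i # s))) \<subseteq> topspace Z - Y"
    proof (intro UN_least subsetI DiffI notI)
      fix s p assume p: "p \<in> ?D s - (\<Union>i. W (i # s))"
      then have "p \<in> W s" using DW by blast
      then show "p \<in> topspace Z" using openin_subset[OF W] by blast
      assume "p \<in> Y"
      then show False using step[OF _ \<open>p \<in> W s\<close>] p by blast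
    qed
    show "topspace Z - Y \<subseteq> (\<Union>s. ?D s - (\<Union>i. W (i # s)))"
    proof (rule subsetI, rule ccontr)
      fix p assume p: "p \<in> topspace Z - Y" and "p \<notin> (\<Union>s. ?D s - (\<Union>i. W (i # s)))"
      then have ex: "\<exists>i. p \<in> W (i # s)" if "p \<in> ?D s" for s
        using that by (simp only: UN_iff DiffI UNIV_I bex_simps) blast
      \<comment> \<open>Choosing the least admissible index keeps \<open>p\<close> outside all
        earlier \<open>W (j # s)\<close>, as \<open>greedy_part\<close> demands. A point that never
        gets stuck thus follows an infinite branch, and \<open>branch\<close> puts it into
        \<open>Y\<close>.\<close>
      define h where "h s = (LEAST i. p \<in> W (i # s))" for s
      have h: "p \<in> ?D (h s # s)" if s: "p \<in> ?D s" for s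
      proof -
        have "p \<in> W (h s # s)"
          unfolding h_def using ex[OF s] by (rule LeastI_ex)
        moreover have "p \<notin> W (j # s)" if "j < h s" for j
          using that unfolding h_def by (rule not_less_Least)
        ultimately show ?thesis using s by simp
      qed
      define t where "t = rec_nat [] (\<lambda>_ s. h s # s)"
      have t: "t 0 = []" "t (Suc n) = h (t n) # t n" for n by (auto simp: t_def)
      have "p \<in> ?D (t n)" for n
      proof (induction n)
        case 0 then show ?case using p by (simp add: t)
      next
        case (Suc n) then show ?case unfolding t(2) by (rule h)
      qed
      then have pW: "p \<in> W (t n)" for n using DW by blast
      have seg: "initial_segment (\<lambda>n. h (t n)) n = t n" for n
        by (induction n) (auto simp: t)
      show False using branch[of p "\<lambda>n. h (t n)"] p pW unfolding seg by blast
    qed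
  qed
  moreover have "fsigma_in Z (\<Union>s. ?D s - (\<Union>i. W (i # s)))"
  proof (rule fsigma_in_Union)
    fix S assume "S \<in> range (\<lambda>s. ?D s - (\<Union>i. W (i # s)))"
    then obtain s where "S = ?D s - (\<Union>i. W (i # s))" by (rule rangeE)
    then show "fsigma_in Z S" using fs by (simp only:)
  qed simp
  ultimately show ?thesis
    using Y by (simp only: gdelta_in_fsigma_in)
qed

section \<open>Resolutions in metric spaces: separability and the G-delta property\<close>

context Metric_space
begin

text \<open>The member of a cover that contains \<open>x\<close> contains a ball about
  \<open>x\<close>, hence all but finitely many \<open>L i\<close>; the others have a compact
  union.\<close>

lemma compactin_insert_Union:
  assumes x: "x \<in> M" and L: "\<And>i. compactin mtopology (L i)"
    and sub: "\<And>i. L i \<subseteq> mball x (r i)" and r: "r \<longlonglongrightarrow> 0"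
  shows "compactin mtopology (insert x (\<Union>i::nat. L i))"
  unfolding compactin_def
proof (intro conjI allI impI)
  show "insert x (\<Union>i. L i) \<subseteq> topspace mtopology"
    using x compactin_subset_topspace[OF L] by auto
  fix \<U> assume \<U>: "Ball \<U> (openin mtopology) \<and> insert x (\<Union>i. L i) \<subseteq> \<Union>\<U>"
  then obtain U e where U: "U \<in> \<U>" "x \<in> U" "0 < e" "mball x e \<subseteq> U"
    by (meson UnionE insert_subset openin_mtopology)
  obtain N where N: "\<And>i. N \<le> i \<Longrightarrow> r i < e"
    using order_tendstoD(2)[OF r \<open>0 < e\<close>] by (auto simp: eventually_sequentially)
  have "compactin mtopology (\<Union>i<N. L i)"
    using L by (intro compactin_Union) auto
  moreover have "(\<Union>i<N. L i) \<subseteq> \<Union>\<U>" using \<U> by blast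
  ultimately obtain \<F> where \<F>: "finite \<F>" "\<F> \<subseteq> \<U>" "(\<Union>i<N. L i) \<subseteq> \<Union>\<F>"
    using compactinD \<U> by metis
  have "L i \<subseteq> U" if "N \<le> i" for i
    using sub[of i] mball_subset_concentric[OF less_imp_le[OF N[OF that]], of x] U(4) by blast
  moreover have "L i \<subseteq> \<Union>\<F>" if "i < N" for i
    using \<F>(3) that by blast
  ultimately have "L i \<subseteq> \<Union>(insert U \<F>)" for i
    by (cases "i < N") (auto simp: not_less)
  then have "insert x (\<Union>i. L i) \<subseteq> \<Union>(insert U \<F>)"
    using U(2) by blast
  then show "\<exists>\<F>. finite \<F> \<and> \<F> \<subseteq> \<U> \<and> insert x (\<Union>i. L i) \<subseteq> \<Union>\<F>"
    using \<F> U(1) by (intro exI[of _ "insert U \<F>"]) auto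
qed

text \<open>For each radius, every \<alpha> has an initial segment whose set \<open>Q\<close> has a
  finite net; otherwise a separated infinite sequence could be chosen along \<alpha>, and the
  diagonal argument would put it into one compact set. There are only countably many finite
  sequences, so the nets together form a countable dense set.\<close>

lemma separable_space_resolution:
  assumes "compact_resolution mtopology K"
  shows "separable_space mtopology"
proof -
  have K: "\<And>\<alpha>. compactin mtopology (K \<alpha>)" "M = (\<Union>\<alpha>. K \<alpha>)" "\<And>\<alpha> \<beta>. \<alpha> \<le> \<beta> \<Longrightarrow> K \<alpha> \<subseteq> K \<beta>"
    using assms unfolding compact_resolution_def by auto
  define Q where "Q s = (\<Union>\<alpha>\<in>{\<alpha>. initial_segment \<alpha> (length s) = s}. K \<alpha>)" for s
  define net where "net s e F \<longleftrightarrow> finite F \<and> F \<subseteq> M \<and> Q s \<subseteq> (\<Union>y\<in>F. mball y e)" for s e F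
  have ex_net: "\<exists>n F. net (initial_segment \<alpha> n) e F" if "0 < e" for \<alpha> e
  proof (rule ccontr)
    assume no: "\<nexists>n F. net (initial_segment \<alpha> n) e F"
    \<comment> \<open>The choice never stops: at stage \<open>n\<close> the finitely many balls
      about the earlier points do not cover \<open>Q (initial_segment \<alpha> n)\<close>.\<close>
    have "\<exists>x. \<forall>n. x n \<in> Q (initial_segment \<alpha> n) \<and> x n \<notin> (\<Union>j<n. mball (x j) e)"
    proof (rule dependent_wellorder_choice, goal_cases)
      case (1 r f g n) then show ?case by simp
    next
      case (2 n f)
      have "f ` {..<n} \<subseteq> M" using 2 K(2) unfolding Q_def by blast
      then have "\<not> Q (initial_segment \<alpha> n) \<subseteq> (\<Union>y\<in>f ` {..<n}. mball y e)"
        using no net_def finite_imageI[OF finite_lessThan] by (metis (no_types, lifting))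
      then show ?case by auto
    qed
    then obtain x where x: "\<And>n. x n \<in> Q (initial_segment \<alpha> n)"
      "\<And>n. x n \<notin> (\<Union>j<n. mball (x j) e)" by blast
    have "\<exists>a. \<forall>n. x n \<in> K (a n) \<and> initial_segment (a n) n = initial_segment \<alpha> n"
      using x(1) unfolding Q_def length_initial_segment by (intro choice) blast
    then obtain \<beta> where \<beta>: "\<And>n. x n \<in> K \<beta>"
      using resolution_diagonal[of K x _ \<alpha>] K(3) by metis
    have "mtotally_bounded (K \<beta>)" using K(1) by (rule compactin_imp_mtotally_bounded)
    then obtain F where F: "finite F" "F \<subseteq> K \<beta>" "K \<beta> \<subseteq> (\<Union>y\<in>F. mball y (e/2))"
      unfolding mtotally_bounded_def using \<open>0 < e\<close> by (meson half_gt_zero)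
    then have "\<exists>c. \<forall>n. c n \<in> F \<and> x n \<in> mball (c n) (e/2)"
      using \<beta> by (intro choice) blast
    then obtain c where c: "\<And>n. c n \<in> F" "\<And>n. x n \<in> mball (c n) (e/2)" by blast
    \<comment> \<open>Pigeonhole: two terms of the sequence share a centre of radius
      \<open>e/2\<close>, so they are closer than \<open>e\<close>, against the separation.\<close>
    have "\<not> inj c"
      using F(1) c(1) by (meson finite_subset image_subsetI infinite_UNIV_nat finite_imageD)
    then obtain j n where "j < n" "c j = c n"
      unfolding inj_def by (metis linorder_neqE_nat)
    then have "d (x j) (x n) < e"
      using c(2)[of j] c(2)[of n] triangle[of "x j" "c n" "x n"] by (auto simp: commute)
    then show False
      using x(2)[of n] \<open>j < n\<close> c(2) by auto
  qed
  define sel where "sel s m = (SOME F. net s (inverse (Suc m)) F)" for s m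
  define C where "C = (\<Union>(s, m)\<in>{(s, m). \<exists>F. net s (inverse (Suc m)) F}. sel s m)"
  have sel: "net s (inverse (Suc m)) (sel s m)" if "\<exists>F. net s (inverse (Suc m)) F" for s m
    unfolding sel_def using that by (rule someI_ex)
  have "countable (sel s m)" "sel s m \<subseteq> M" if "\<exists>F. net s (inverse (Suc m)) F" for s m
    using sel[OF that] by (auto simp: net_def countable_finite)
  then have "countable C" "C \<subseteq> M"
    unfolding C_def by (auto intro!: countable_UN) blast
  moreover have "mtopology closure_of C = M"
  proof -
    have "\<exists>y\<in>C. y \<in> mball x e" if "x \<in> M" "0 < e" for x e
    proof -
      obtain m where m: "inverse (Suc m) < e" using reals_Archimedean[OF \<open>0 < e\<close>] by auto
      obtain \<alpha> where \<alpha>: "x \<in> K \<alpha>" using K(2) \<open>x \<in> M\<close> by blast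
      obtain n where n: "\<exists>F. net (initial_segment \<alpha> n) (inverse (Suc m)) F"
        using ex_net[of "inverse (Suc m)" \<alpha>] by auto
      have "x \<in> Q (initial_segment \<alpha> n)" using \<alpha> unfolding Q_def by auto
      then obtain y where "y \<in> sel (initial_segment \<alpha> n) m" "x \<in> mball y (inverse (Suc m))"
        using sel[OF n] unfolding net_def by blast
      then show ?thesis
        using n m by (intro bexI[of _ y]) (auto simp: C_def commute intro!: exI[of _ "initial_segment \<alpha> n"])
    qed
    then show ?thesis
      unfolding metric_closure_of by blast
  qed
  ultimately show ?thesis
    unfolding separable_space_def topspace_mtopology by blast
qed

text \<open>A set V is called good for s if the compact subsets of V can be swallowed by sets
  \<open>K \<alpha>\<close> with \<open>\<alpha>\<close> extending s.  Some one-step extension of s is good for a neighbourhood of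
  a given point of a good set: otherwise there would be bad compact sets converging to the point,
  whose union is swallowed by a single \<open>K \<alpha>\<close>.\<close>

lemma gdelta_in_resolution:
  assumes Y: "Y \<subseteq> M" "mtopology closure_of Y = M"
    and res: "compact_resolution (subtopology mtopology Y) K"
    and swallow: "swallows_compact_sets (subtopology mtopology Y) K"
  shows "gdelta_in mtopology Y"
proof -
  have K: "\<And>\<alpha>. compactin mtopology (K \<alpha>)" "\<And>\<alpha>. K \<alpha> \<subseteq> Y" "\<And>\<alpha> \<beta>. \<alpha> \<le> \<beta> \<Longrightarrow> K \<alpha> \<subseteq> K \<beta>"
    using res unfolding compact_resolution_def by (auto simp: compactin_subtopology)
  have sw: "\<exists>\<alpha>. L \<subseteq> K \<alpha>" if "compactin mtopology L" "L \<subseteq> Y" for L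
    using swallow that unfolding swallows_compact_sets_def by (auto simp: compactin_subtopology)
  define good where "good s V \<longleftrightarrow> (\<forall>L. compactin mtopology L \<and> L \<subseteq> V \<inter> Y \<longrightarrow>
      (\<exists>\<alpha>. initial_segment \<alpha> (length s) = s \<and> L \<subseteq> K \<alpha>))" for s V
  define W where "W s = \<Union>{V. openin mtopology V \<and> good s V}" for s
  have W: "x \<in> W s \<longleftrightarrow> (\<exists>V. openin mtopology V \<and> good s V \<and> x \<in> V)" for x s
    unfolding W_def by blast
  show ?thesis
  proof (rule gdelta_in_greedy)
    show "metrizable_space mtopology" by (rule metrizable_space_mtopology)
    show "openin mtopology (W s)" for s unfolding W_def by (rule openin_Union) simp
    have "good [] M" unfolding good_def using sw by auto
    then show "W [] = topspace mtopology"
      unfolding W_def using openin_subset[of mtopology] openin_topspace[of mtopology] by auto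
    show "Y \<subseteq> topspace mtopology" using Y by simp
  next
    fix x s assume x: "x \<in> Y" "x \<in> W s"
    then obtain V where V: "openin mtopology V" "good s V" "x \<in> V" using W by blast
    then obtain r where r: "0 < r" "mball x r \<subseteq> V" by (auto simp: openin_mtopology)
    show "\<exists>i. x \<in> W (i # s)"
    proof (rule ccontr)
      assume no: "\<nexists>i. x \<in> W (i # s)"
      \<comment> \<open>These radii tend to 0, as convergence to \<open>x\<close> requires, and
        never exceed \<open>r\<close>, so that all the bad sets stay inside
        \<open>V\<close>.\<close>
      let ?r = "\<lambda>i. r * inverse (real (Suc i))"
      have "\<not> good (i # s) (mball x (?r i))" for i
      proof -
        have "x \<in> mball x (?r i)" using x Y r by auto
        then show ?thesis using no W openin_mball by blast
      qed
      then have "\<exists>L. \<forall>i. compactin mtopology (L i) \<and> L i \<subseteq> mball x (?r i) \<inter> Y \<and>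
          \<not> (\<exists>\<alpha>. initial_segment \<alpha> (length (i # s)) = i # s \<and> L i \<subseteq> K \<alpha>)"
        unfolding good_def by (intro choice) blast
      then obtain L where L: "\<And>i. compactin mtopology (L i)" "\<And>i. L i \<subseteq> mball x (?r i)"
        "\<And>i. L i \<subseteq> Y" "\<And>i \<alpha>. initial_segment \<alpha> (length (i # s)) = i # s \<Longrightarrow> \<not> L i \<subseteq> K \<alpha>"
        by (metis le_inf_iff)
      have lim: "?r \<longlonglongrightarrow> 0"
        using tendsto_mult_right_zero[OF LIMSEQ_inverse_real_of_nat] .
      have "compactin mtopology (insert x (\<Union>i. L i))"
        using subsetD[OF Y(1) x(1)] L(1,2) lim by (rule compactin_insert_Union)
      moreover have "insert x (\<Union>i. L i) \<subseteq> V \<inter> Y"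
      proof -
        have "?r i \<le> r" for i
          using r(1) by (simp add: mult_left_le inverse_le_1_iff)
        then have "mball x (?r i) \<subseteq> V" for i
          using mball_subset_concentric r(2) by (meson subset_trans)
        then show ?thesis using L(2,3) x V(3) by blast
      qed
      ultimately obtain \<alpha> where \<alpha>: "initial_segment \<alpha> (length s) = s" "insert x (\<Union>i. L i) \<subseteq> K \<alpha>"
        using V(2) unfolding good_def by meson
      \<comment> \<open>An \<alpha> extending \<open>s\<close> also extends \<open>i # s\<close> for
        \<open>i = \<alpha> (length s)\<close>, the next entry; for this \<open>i\<close> the set
        \<open>L i\<close> was chosen not to lie in \<open>K \<alpha>\<close>.\<close>
      show False
        using L(4)[of \<alpha> "\<alpha> (length s)"] \<alpha> by auto
    qed
  next
    fix p \<alpha> assume p: "p \<in> topspace mtopology" and pW: "\<And>n. p \<in> W (initial_segment \<alpha> n)"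
    \<comment> \<open>Density of \<open>Y\<close> supplies a point \<open>y\<close> of
      \<open>Y\<close> in the good set near \<open>p\<close>; goodness is applied to the compact set
      \<open>{y}\<close>. The \<open>y n\<close> converge to \<open>p\<close>, and once the diagonal
      argument has put them into one \<open>K \<beta>\<close>, closedness of that set gives
      \<open>p \<in> Y\<close>.\<close>
    have "\<exists>y a. y \<in> K a \<and> initial_segment a n = initial_segment \<alpha> n \<and> d p y < inverse (Suc n)" for n
    proof -
      obtain V where V: "openin mtopology V" "good (initial_segment \<alpha> n) V" "p \<in> V"
        using pW[of n] W by blast
      let ?U = "V \<inter> mball p (inverse (Suc n))"
      have U: "openin mtopology ?U" "p \<in> ?U" using V p by auto
      have "p \<in> mtopology closure_of Y" using Y(2) p by simp
      then have "\<forall>T. p \<in> T \<and> openin mtopology T \<longrightarrow> (\<exists>y. y \<in> Y \<and> y \<in> T)"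
        unfolding in_closure_of by (rule conjunct2)
      then have "\<exists>y. y \<in> Y \<and> y \<in> ?U" using U by (elim allE[where x = ?U]) simp
      then obtain y where y: "y \<in> Y" "y \<in> V" "y \<in> mball p (inverse (Suc n))" by auto
      then have "compactin mtopology {y}" "{y} \<subseteq> V \<inter> Y" by auto
      then show ?thesis
        using V(2) y unfolding good_def by fastforce
    qed
    then obtain y a where y: "\<And>n. y n \<in> K (a n)" "\<And>n. initial_segment (a n) n = initial_segment \<alpha> n"
      "\<And>n. d p (y n) < inverse (Suc n)" by metis
    obtain \<beta> where \<beta>: "\<And>n. y n \<in> K \<beta>"
      by (rule resolution_diagonal[of K y a \<alpha>]) (use K(3) y in auto)
    have "closedin mtopology (K \<beta>)"
      using K(1) Hausdorff_space_mtopology compactin_imp_closedin by blast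
    moreover have "\<exists>z\<in>K \<beta>. z \<in> mball p e" if e: "0 < e" for e
    proof -
      obtain n where "inverse (Suc n) < e" using reals_Archimedean[OF e] by auto
      then have "d p (y n) < e" using y(3)[of n] by simp
      moreover have "y n \<in> M" using \<beta> K(2) Y by blast
      ultimately show ?thesis using \<beta> p by auto
    qed
    then have "p \<in> mtopology closure_of (K \<beta>)"
      unfolding metric_closure_of using p by auto
    ultimately show "p \<in> Y" using K(2) closure_of_closedin by blast
  qed
qed

end

section \<open>Transport of resolutions along proper maps, and Christensen's theorem\<close>

lemma compact_resolutionD:
  assumes "compact_resolution X K"
  shows "compactin X (K \<alpha>)" "topspace X = (\<Union>\<alpha>. K \<alpha>)" "\<alpha> \<le> \<beta> \<Longrightarrow> K \<alpha> \<subseteq> K \<beta>"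
  using assms unfolding compact_resolution_def by auto

lemma swallows_compact_setsE:
  assumes "swallows_compact_sets X K" "compactin X C"
  obtains \<alpha> where "C \<subseteq> K \<alpha>"
  using assms unfolding swallows_compact_sets_def by auto

text \<open>Properness is what transfers swallowing: the preimage of a compact set is compact, hence
  swallowed upstairs, and surjectivity carries it back onto the given set.\<close>

lemma compact_resolution_image:
  assumes f: "proper_map X Y f" "continuous_map X Y f" "f ` topspace X = topspace Y"
    and K: "compact_resolution X K" "swallows_compact_sets X K"
  shows "compact_resolution Y (\<lambda>\<alpha>. f ` K \<alpha>)" "swallows_compact_sets Y (\<lambda>\<alpha>. f ` K \<alpha>)"
proof -
  show "compact_resolution Y (\<lambda>\<alpha>. f ` K \<alpha>)"
    unfolding compact_resolution_def
  proof (intro conjI allI impI)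
    show "topspace Y = (\<Union>\<alpha>. f ` K \<alpha>)"
      unfolding f(3)[symmetric] compact_resolutionD(2)[OF K(1)] by (rule image_UN)
    show "compactin Y (f ` K \<alpha>)" for \<alpha>
      by (rule image_compactin[OF compact_resolutionD(1)[OF K(1)] f(2)])
    show "f ` K \<alpha> \<subseteq> f ` K \<beta>" if "\<alpha> \<le> \<beta>" for \<alpha> \<beta>
      by (rule image_mono[OF compact_resolutionD(3)[OF K(1) that]])
  qed
  show "swallows_compact_sets Y (\<lambda>\<alpha>. f ` K \<alpha>)"
    unfolding swallows_compact_sets_def
  proof (intro allI impI)
    fix C assume C: "compactin Y C"
    then have "compactin X {x \<in> topspace X. f x \<in> C}"
      by (rule compactin_proper_map_preimage[OF f(1)])
    then obtain \<alpha> where "{x \<in> topspace X. f x \<in> C} \<subseteq> K \<alpha>"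
      by (rule swallows_compact_setsE[OF K(2)])
    then have "f ` {x \<in> topspace X. f x \<in> C} \<subseteq> f ` K \<alpha>" by (rule image_mono)
    moreover have "C \<subseteq> f ` {x \<in> topspace X. f x \<in> C}"
      using compactin_subset_topspace[OF C] unfolding f(3)[symmetric] by blast
    ultimately have "C \<subseteq> f ` K \<alpha>" by (rule subset_trans[rotated])
    then show "\<exists>\<alpha>. C \<subseteq> f ` K \<alpha>" by blast
  qed
qed

lemma compact_resolution_preimage:
  assumes f: "proper_map X Y f" "continuous_map X Y f"
    and K: "compact_resolution Y K" "swallows_compact_sets Y K"
  shows "compact_resolution X (\<lambda>\<alpha>. {x \<in> topspace X. f x \<in> K \<alpha>})"
    "swallows_compact_sets X (\<lambda>\<alpha>. {x \<in> topspace X. f x \<in> K \<alpha>})"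
proof -
  note K1 = compact_resolutionD[OF K(1)]
  have "f ` topspace X \<subseteq> (\<Union>\<alpha>. K \<alpha>)"
    using continuous_map_image_subset_topspace[OF f(2)] K1(2) by simp
  then have "topspace X = (\<Union>\<alpha>. {x \<in> topspace X. f x \<in> K \<alpha>})" by auto
  then show "compact_resolution X (\<lambda>\<alpha>. {x \<in> topspace X. f x \<in> K \<alpha>})"
    unfolding compact_resolution_def
    using K1(3) by (intro conjI allI impI compactin_proper_map_preimage[OF f(1) K1(1)]) auto
  show "swallows_compact_sets X (\<lambda>\<alpha>. {x \<in> topspace X. f x \<in> K \<alpha>})"
    unfolding swallows_compact_sets_def
  proof (intro allI impI)
    fix C assume C: "compactin X C"
    obtain \<alpha> where "f ` C \<subseteq> K \<alpha>"
      using image_compactin[OF C f(2)] by (rule swallows_compact_setsE[OF K(2)])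
    then show "\<exists>\<alpha>. C \<subseteq> {x \<in> topspace X. f x \<in> K \<alpha>}"
      using compactin_subset_topspace[OF C] by blast
  qed
qed

text \<open>Complete metrizability passes to G-delta subsets, so it is enough to view
  \<open>Y\<close> as a dense subspace of its completion. Separability is obtained directly in a
  metric of \<open>Y\<close>.\<close>

theorem Christensen:
  assumes "metrizable_space Y" "compact_resolution Y K" "swallows_compact_sets Y K"
  shows "Polish_space Y"
proof -
  obtain f :: "'a \<Rightarrow> 'a \<Rightarrow> real" and Z where Z: "completely_metrizable_space Z"
    and f: "embedding_map Y Z f" and dense: "Z closure_of (f ` topspace Y) = topspace Z"
    using metrizable_space_completion[OF assms(1)] .
  let ?S = "subtopology Z (f ` topspace Y)"
  have hom: "homeomorphic_map Y ?S f" using f unfolding embedding_map_def .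
  have res: "compact_resolution ?S (\<lambda>\<alpha>. f ` K \<alpha>)" "swallows_compact_sets ?S (\<lambda>\<alpha>. f ` K \<alpha>)"
    by (rule compact_resolution_image[OF homeomorphic_imp_proper_map[OF hom]
          homeomorphic_imp_continuous_map[OF hom] homeomorphic_imp_surjective_map[OF hom] assms(2,3)])+
  obtain M d where M: "Metric_space M d" "Z = Metric_space.mtopology M d"
    using Z unfolding completely_metrizable_space_def by blast
  interpret Metric_space M d by (fact M(1))
  have "f ` topspace Y = topspace Z \<inter> f ` topspace Y"
    using homeomorphic_imp_surjective_map[OF hom] by (simp only: topspace_subtopology)
  then have sub: "f ` topspace Y \<subseteq> topspace Z" by blast
  have "gdelta_in Z (f ` topspace Y)"
    unfolding M(2)
    by (rule gdelta_in_resolution) (use sub dense res in \<open>simp_all only: M(2) topspace_mtopology\<close>)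
  then have "completely_metrizable_space ?S"
    using Z by (rule completely_metrizable_space_gdelta_in[rotated])
  then have "completely_metrizable_space Y"
    using hom homeomorphic_completely_metrizable_space homeomorphic_map_imp_homeomorphic_space by blast
  moreover obtain M' d' where M': "Metric_space M' d'" "Y = Metric_space.mtopology M' d'"
    using assms(1) unfolding metrizable_space_def by blast
  ultimately show ?thesis
    unfolding Polish_space_def using Metric_space.separable_space_resolution[OF M'(1)] assms(2) by blast
qed

section \<open>Polish spaces and Cech-completeness\<close>

text \<open>The definition of \<open>mtotally_bounded\<close> requires centres in \<open>S\<close>.
  Each useful centre is replaced by a point of \<open>S\<close> at distance at most
  \<open>e/3\<close>, which costs \<open>2 * e/3 < e\<close> in total.\<close>

lemma (in Metric_space) mtotally_boundedI:
  assumes "S \<subseteq> M"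
    and net: "\<And>e. 0 < e \<Longrightarrow> \<exists>F. finite F \<and> S \<subseteq> (\<Union>y\<in>F. mcball y e)"
  shows "mtotally_bounded S"
  unfolding mtotally_bounded_def
proof (intro allI impI)
  fix e :: real assume e: "0 < e"
  then obtain F where F: "finite F" "S \<subseteq> (\<Union>y\<in>F. mcball y (e/3))"
    using net[of "e/3"] by auto
  define F' where "F' = {y \<in> F. \<exists>x\<in>S. x \<in> mcball y (e/3)}"
  have "\<forall>y\<in>F'. \<exists>x. x \<in> S \<and> x \<in> mcball y (e/3)" unfolding F'_def by blast
  then obtain g where g: "\<And>y. y \<in> F' \<Longrightarrow> g y \<in> S \<and> g y \<in> mcball y (e/3)" by metis
  show "\<exists>K. finite K \<and> K \<subseteq> S \<and> S \<subseteq> (\<Union>x\<in>K. mball x e)"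
  proof (intro exI conjI)
    show "finite (g ` F')" using F(1) by (simp add: F'_def)
    show "g ` F' \<subseteq> S" using g by blast
    show "S \<subseteq> (\<Union>x\<in>g ` F'. mball x e)"
    proof
      fix x assume x: "x \<in> S"
      then obtain y where y: "y \<in> F" "x \<in> mcball y (e/3)" using F(2) by blast
      then have y': "y \<in> F'" using x unfolding F'_def by blast
      have "d (g y) x \<le> d (g y) y + d y x"
        using g[OF y'] y(2) by (intro triangle) auto
      then have "x \<in> mball (g y) e"
        using g[OF y'] y(2) e by (auto simp: commute)
      then show "x \<in> (\<Union>x\<in>g ` F'. mball x e)" using y' by blast
    qed
  qed
qed

text \<open>The value \<open>\<alpha> n\<close> says how many balls of radius \<open>r n\<close>
  about a dense sequence may be used. The sets \<open>K \<alpha>\<close> are closed and totally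
  bounded, hence compact by completeness; a compact set lies in one of them because finitely many
  balls suffice at every scale.\<close>

lemma Polish_space_resolution:
  assumes "Polish_space Y"
  obtains K where "compact_resolution Y K" "swallows_compact_sets Y K"
proof -
  obtain M d where M: "Metric_space M d" and complete: "Metric_space.mcomplete M d"
    and Y: "Y = Metric_space.mtopology M d"
    using assms unfolding Polish_space_def completely_metrizable_space_def by blast
  interpret Metric_space M d by (fact M)
  obtain D where D: "countable D" "D \<subseteq> M" "mtopology closure_of D = M"
    using assms unfolding Polish_space_def separable_space_def Y by auto
  \<comment> \<open>For empty \<open>D\<close> the values of \<open>q\<close> are arbitrary, but
    then \<open>M\<close> is empty as well.\<close>
  define q where "q = from_nat_into D"
  define r where "r n = inverse (real (Suc n))" for n
  have r: "0 < r n" for n by (simp add: r_def)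
  define K where "K \<alpha> = M \<inter> (\<Inter>n. \<Union>i\<in>{..\<alpha> n}. mcball (q i) (r n))" for \<alpha>
  have cover: "M \<subseteq> (\<Union>i. mball (q i) (r n))" for n
  proof
    fix x assume x: "x \<in> M"
    then have "\<exists>y\<in>D. y \<in> mball x (r n)"
      using D(3) r[of n] unfolding metric_closure_of by blast
    then obtain y where y: "y \<in> D" "x \<in> mball y (r n)" by (auto simp: commute)
    then have "q (to_nat_on D y) = y" unfolding q_def using D(1) by simp
    then show "x \<in> (\<Union>i. mball (q i) (r n))" using y by (intro UN_I[of "to_nat_on D y"]) auto
  qed
  have swallow: "\<exists>\<alpha>. C \<subseteq> K \<alpha>" if C: "compactin mtopology C" for C
  proof -
    have "\<exists>k. C \<subseteq> (\<Union>i\<in>{..k}. mcball (q i) (r n))" for n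
    proof -
      have "C \<subseteq> \<Union> (range (\<lambda>i. mball (q i) (r n)))"
        using cover[of n] compactin_subset_topspace[OF C] by auto
      then obtain \<F> where \<F>: "finite \<F>" "\<F> \<subseteq> range (\<lambda>i. mball (q i) (r n))" "C \<subseteq> \<Union>\<F>"
        using compactinD[OF C, of "range (\<lambda>i. mball (q i) (r n))"] openin_mball by blast
      obtain I where I: "finite I" "\<F> = (\<lambda>i. mball (q i) (r n)) ` I"
        using finite_subset_image[OF \<F>(1,2)] by blast
      obtain k where "I \<subseteq> {..k}" using finite_nat_iff_bounded_le[of I] I(1) by blast
      then have "\<Union>\<F> \<subseteq> (\<Union>i\<in>{..k}. mcball (q i) (r n))"
        unfolding I(2) using mball_subset_mcball by (intro UN_mono) auto
      then show ?thesis using \<F>(3) by (meson subset_trans)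
    qed
    then obtain \<alpha> where \<alpha>: "\<And>n. C \<subseteq> (\<Union>i\<in>{..\<alpha> n}. mcball (q i) (r n))" by metis
    have "C \<subseteq> K \<alpha>"
      unfolding K_def using compactin_subset_topspace[OF C] \<alpha>
      by (intro Int_greatest INT_greatest) simp_all
    then show ?thesis by blast
  qed
  have compact: "compactin mtopology (K \<alpha>)" for \<alpha>
  proof -
    have "closedin mtopology (\<Inter>n. \<Union>i\<in>{..\<alpha> n}. mcball (q i) (r n))"
      by (intro closedin_Inter) (auto intro!: closedin_Union)
    then have "closedin mtopology (K \<alpha>)"
      unfolding K_def using closedin_topspace[of mtopology] by (intro closedin_Int) auto
    moreover have "mtotally_bounded (K \<alpha>)"
    proof (rule mtotally_boundedI)
      fix e :: real assume "0 < e"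
      then obtain n where n: "r n < e" unfolding r_def using reals_Archimedean by blast
      have "K \<alpha> \<subseteq> (\<Union>i\<in>{..\<alpha> n}. mcball (q i) (r n))" unfolding K_def by blast
      also have "\<dots> \<subseteq> (\<Union>i\<in>{..\<alpha> n}. mcball (q i) e)"
        using n by (intro UN_mono mcball_subset_concentric) auto
      also have "\<dots> = (\<Union>y\<in>q ` {..\<alpha> n}. mcball y e)" by simp
      finally show "\<exists>F. finite F \<and> K \<alpha> \<subseteq> (\<Union>y\<in>F. mcball y e)" by blast
    qed (simp add: K_def)
    ultimately show ?thesis
      using mtotally_bounded_eq_compact_closure_of[OF complete] closure_of_closedin by metis
  qed
  have "compact_resolution Y K"
    unfolding compact_resolution_def Y
  proof (intro conjI allI impI compact)
    show "topspace mtopology = (\<Union>\<alpha>. K \<alpha>)"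
    proof
      show "topspace mtopology \<subseteq> (\<Union>\<alpha>. K \<alpha>)"
      proof
        fix x assume "x \<in> topspace mtopology"
        then have "compactin mtopology {x}" by simp
        then show "x \<in> (\<Union>\<alpha>. K \<alpha>)" using swallow by blast
      qed
    qed (auto simp: K_def)
    show "K \<alpha> \<subseteq> K \<beta>" if "\<alpha> \<le> \<beta>" for \<alpha> \<beta>
      unfolding K_def using le_funD[OF that]
      by (intro Int_mono INT_anti_mono UN_mono subset_refl) auto
  qed
  moreover have "swallows_compact_sets Y K"
    unfolding swallows_compact_sets_def Y using swallow by blast
  ultimately show thesis by (rule that)
qed

section \<open>The Stone-Cech compactification and its traces on the space\<close>

lemma stone_cech_embedding_in_cube:
  assumes "x \<in> topspace X"
  shows "stone_cech_embedding X x \<in> (\<Pi>\<^sub>E f\<in>unit_interval_maps X. {0..1})"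
  using assms unfolding stone_cech_embedding_def unit_interval_maps_def
  by (auto simp: continuous_map_in_subtopology Pi_iff)

lemma
  fixes X :: "'a topology"
  defines "e \<equiv> stone_cech_embedding X"
  shows compact_space_stone_cech: "compact_space (stone_cech X)"
    and Hausdorff_space_stone_cech: "Hausdorff_space (stone_cech X)"
    and dense_stone_cech: "stone_cech X closure_of (e ` topspace X) = topspace (stone_cech X)"
    and image_stone_cech: "e ` topspace X \<subseteq> topspace (stone_cech X)"
    and continuous_map_stone_cech: "continuous_map X (stone_cech X) e"
    and continuous_map_stone_cech_proj: "f \<in> unit_interval_maps X \<Longrightarrow>
      continuous_map (stone_cech X) euclideanreal (\<lambda>p. p f)"
proof -
  define Q where "Q = product_topology (\<lambda>_. top_of_set {0..1::real}) (unit_interval_maps X)"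
  have B: "stone_cech X = subtopology Q (Q closure_of (e ` topspace X))"
    unfolding stone_cech_def Q_def e_def Let_def ..
  have "compact_space Q" unfolding Q_def
    by (simp add: compact_space_product_topology compact_space_subtopology)
  then show "compact_space (stone_cech X)"
    unfolding B by (intro compact_space_subtopology closedin_compact_space) auto
  have "Hausdorff_space Q" unfolding Q_def
    by (simp add: Hausdorff_space_product_topology Hausdorff_space_subtopology)
  then show "Hausdorff_space (stone_cech X)" unfolding B by (rule Hausdorff_space_subtopology)
  have eQ: "e ` topspace X \<subseteq> topspace Q"
    unfolding Q_def e_def using stone_cech_embedding_in_cube[of _ X] by auto
  then have sub: "e ` topspace X \<subseteq> Q closure_of (e ` topspace X)"
    by (rule closure_of_subset)
  show "stone_cech X closure_of (e ` topspace X) = topspace (stone_cech X)"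
    unfolding B closure_of_subtopology using sub closure_of_subset_topspace[of Q]
    by (simp add: Int_absorb1)
  show "e ` topspace X \<subseteq> topspace (stone_cech X)"
    unfolding B using sub eQ by auto
  have "continuous_map X Q e"
    unfolding Q_def continuous_map_componentwise
  proof (intro conjI ballI)
    show "e ` topspace X \<subseteq> extensional (unit_interval_maps X)"
      unfolding e_def stone_cech_embedding_def by auto
    fix f assume f: "f \<in> unit_interval_maps X"
    then have "e x f = f x" for x unfolding e_def stone_cech_embedding_def by simp
    then show "continuous_map X (top_of_set {0..1}) (\<lambda>x. e x f)"
      using f unfolding unit_interval_maps_def by simp
  qed
  then show "continuous_map X (stone_cech X) e"
    unfolding B using sub by (auto simp: continuous_map_in_subtopology)
  show "continuous_map (stone_cech X) euclideanreal (\<lambda>p. p f)" if "f \<in> unit_interval_maps X"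
  proof -
    have "continuous_map Q (top_of_set {0..1}) (\<lambda>p. p f)"
      unfolding Q_def using that by (rule continuous_map_product_projection)
    then have "continuous_map Q euclideanreal (\<lambda>p. p f)"
      by (simp add: continuous_map_in_subtopology)
    then show ?thesis unfolding B by (rule continuous_map_from_subtopology)
  qed
qed

text \<open>A function \<open>g\<close> that is 0 at \<open>x\<close> and 1 off \<open>U\<close> is
  itself a coordinate of the cube; \<open>W\<close> is the set where this coordinate is below
  1.\<close>

lemma stone_cech_trace_subset:
  assumes "completely_regular_space X" "openin X U" "x \<in> U"
  obtains W where "openin (stone_cech X) W" "stone_cech_embedding X x \<in> W"
    "\<And>z. \<lbrakk>z \<in> topspace X; stone_cech_embedding X z \<in> W\<rbrakk> \<Longrightarrow> z \<in> U"
proof -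
  have x: "x \<in> topspace X" using assms(2,3) openin_subset by blast
  have "closedin X (topspace X - U)" "x \<in> topspace X - (topspace X - U)"
    using assms(2,3) x by auto
  then obtain g :: "'a \<Rightarrow> real" where g: "continuous_map X (top_of_set {0..1}) g" "g x = 0"
    "g ` (topspace X - U) \<subseteq> {1}"
    using assms(1) unfolding completely_regular_space_def by meson
  have gI: "g \<in> unit_interval_maps X" using g(1) unfolding unit_interval_maps_def by simp
  have eg: "stone_cech_embedding X z g = g z" for z
    using gI unfolding stone_cech_embedding_def by simp
  let ?W = "{p \<in> topspace (stone_cech X). p g \<in> {..<1}}"
  show thesis
  proof
    show "openin (stone_cech X) ?W"
      using openin_continuous_map_preimage[OF continuous_map_stone_cech_proj[OF gI], of "{..<1}"] by simp
    show "stone_cech_embedding X x \<in> ?W"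
      using image_stone_cech[of X] x g(2) by (auto simp: eg)
    show "z \<in> U" if "z \<in> topspace X" "stone_cech_embedding X z \<in> ?W" for z
      using that g(3) by (auto simp: eg)
  qed
qed

text \<open>The points of the compactification all of whose traces are eventually small for the metric
  of Y form a G-delta set.  At such a point the images of the traces converge to some y in Y, and
  if the point were outside the compact image of the fibre over y, a closed map would separate y
  from the traces.\<close>

lemma Cech_complete_space_proper_map:
  assumes X: "completely_regular_space X" "Hausdorff_space X"
    and f: "proper_map X Y f" "continuous_map X Y f" and Y: "completely_metrizable_space Y"
  shows "Cech_complete_space X"
proof -
  obtain M d where M: "Metric_space M d" and complete: "Metric_space.mcomplete M d"
    and Y: "Y = Metric_space.mtopology M d"
    using Y unfolding completely_metrizable_space_def by blast
  interpret Metric_space M d by (fact M)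
  define B where "B = stone_cech X"
  define e where "e = stone_cech_embedding X"
  have fM: "f x \<in> M" if "x \<in> topspace X" for x
    using continuous_map_image_subset_topspace[OF f(2)] that unfolding Y by auto
  \<comment> \<open>Smallness is tested on the trace of \<open>W\<close> only, since
    \<open>f\<close> is not defined on the rest of the compactification.\<close>
  define small where "small n W \<longleftrightarrow> (\<forall>x\<in>topspace X. \<forall>y\<in>topspace X. e x \<in> W \<longrightarrow> e y \<in> W \<longrightarrow>
      d (f x) (f y) < inverse (Suc n))" for n :: nat and W
  define G where "G n = \<Union>{W. openin B W \<and> small n W}" for n
  have G: "openin B (G n)" for n unfolding G_def by (rule openin_Union) simp
  have "e ` topspace X = (\<Inter>n. G n)"
  proof
    show "e ` topspace X \<subseteq> (\<Inter>n. G n)"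
    proof (clarsimp)
      fix x n assume x: "x \<in> topspace X"
      define r where "r = inverse (real (Suc n)) / 2"
      have 1: "openin X {z \<in> topspace X. f z \<in> mball (f x) r}"
        using f(2) openin_mball unfolding Y by (rule openin_continuous_map_preimage)
      have 2: "x \<in> {z \<in> topspace X. f z \<in> mball (f x) r}"
        using x fM by (simp add: r_def)
      obtain W where W: "openin B W" "e x \<in> W"
        "\<And>z. \<lbrakk>z \<in> topspace X; e z \<in> W\<rbrakk> \<Longrightarrow> z \<in> {z \<in> topspace X. f z \<in> mball (f x) r}"
        unfolding B_def e_def using stone_cech_trace_subset[OF X(1) 1 2] by metis
      have "small n W"
        unfolding small_def
      proof (intro ballI impI)
        fix y z assume "y \<in> topspace X" "z \<in> topspace X" "e y \<in> W" "e z \<in> W"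
        then have "f y \<in> mball (f x) r" "f z \<in> mball (f x) r" using W(3) by blast+
        then show "d (f y) (f z) < inverse (Suc n)"
          using triangle[of "f y" "f x" "f z"] by (simp add: commute r_def)
      qed
      then show "e x \<in> G n" unfolding G_def using W by blast
    qed
    show "(\<Inter>n. G n) \<subseteq> e ` topspace X"
    proof
      fix p assume p: "p \<in> (\<Inter>n. G n)"
      then have "\<forall>n. \<exists>W. openin B W \<and> small n W \<and> p \<in> W" unfolding G_def by blast
      then obtain W where W: "\<And>n. openin B (W n)" "\<And>n. small n (W n)" "\<And>n. p \<in> W n" by metis
      have pB: "p \<in> B closure_of (e ` topspace X)"
        using openin_subset[OF W(1)] W(3)[of 0] unfolding B_def e_def dense_stone_cech by blast
      have trace: "\<exists>x\<in>topspace X. e x \<in> T" if "openin B T" "p \<in> T" for T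
        using pB that unfolding in_closure_of by blast
      \<comment> \<open>Finite intersections make the neighbourhoods decrease, so that points with
        traces in \<open>V n\<close> and \<open>V m\<close> can be compared at every scale up to the
        smaller index.\<close>
      define V where "V n = (\<Inter>k\<le>n. W k)" for n
      have V: "openin B (V n)" "p \<in> V n" for n
        unfolding V_def using W by (auto intro!: openin_Inter)
      have close: "d (f x) (f y) < inverse (Suc k)"
        if "x \<in> topspace X" "y \<in> topspace X" "e x \<in> V n" "e y \<in> V m" "k \<le> n" "k \<le> m" for x y n m k
      proof -
        have "e x \<in> W k" "e y \<in> W k" using that unfolding V_def by auto
        then show ?thesis using W(2)[of k] that unfolding small_def by blast
      qed
      have "\<forall>n. \<exists>x. x \<in> topspace X \<and> e x \<in> V n" using trace V by blast
      then obtain x where x: "\<And>n. x n \<in> topspace X" "\<And>n. e (x n) \<in> V n" by metis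
      have "MCauchy (\<lambda>n. f (x n))"
        unfolding MCauchy_def
      proof (intro conjI allI impI)
        fix \<epsilon> :: real assume "0 < \<epsilon>"
        then obtain k where k: "inverse (Suc k) < \<epsilon>" using reals_Archimedean by auto
        then have "d (f (x n)) (f (x m)) < \<epsilon>" if "k \<le> n" "k \<le> m" for n m
          using close[OF x(1) x(1) x(2) x(2) that] by linarith
        then show "\<exists>N. \<forall>n n'. N \<le> n \<longrightarrow> N \<le> n' \<longrightarrow> d (f (x n)) (f (x n')) < \<epsilon>" by blast
      qed (use fM x in auto)
      then obtain y where y: "limitin mtopology (\<lambda>n. f (x n)) y sequentially"
        using complete unfolding mcomplete_def by blast
      then have yM: "y \<in> M" by (simp add: limitin_metric)
      show "p \<in> e ` topspace X"
      proof (rule ccontr)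
        assume notin: "p \<notin> e ` topspace X"
        let ?F = "{x \<in> topspace X. f x = y}"
        have "compactin X ?F" using f(1) yM unfolding proper_map_def Y by simp
        then have c1: "compactin B (e ` ?F)"
          unfolding B_def e_def using continuous_map_stone_cech by (rule image_compactin)
        have c2: "compactin B {p}"
          using pB in_closure_of by fastforce
        have h: "Hausdorff_space B" unfolding B_def by (rule Hausdorff_space_stone_cech)
        have "disjnt (e ` ?F) {p}" using notin by auto
        then obtain S T where ST: "openin B S" "openin B T" "e ` ?F \<subseteq> S" "{p} \<subseteq> T" "disjnt S T"
          by (rule Hausdorff_space_compact_separation[OF h c1 c2])
        define C where "C = {x \<in> topspace X. e x \<in> topspace B - S}"
        have eB: "e x \<in> topspace B" if "x \<in> topspace X" for x
          unfolding B_def e_def using image_stone_cech imageI[OF that] by (rule subsetD)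
        have "closedin B (topspace B - S)"
          by (rule closedin_diff[OF closedin_topspace ST(1)])
        then have "closedin X C"
          unfolding C_def B_def e_def
          by (rule closedin_continuous_map_preimage[OF continuous_map_stone_cech])
        then have closed: "closedin mtopology (f ` C)"
          using f(1) unfolding proper_map_def closed_map_def Y by blast
        have "\<forall>n. \<exists>z. z \<in> topspace X \<and> e z \<in> T \<inter> V n"
          using trace[OF openin_Int[OF ST(2) V(1)]] ST(4) V(2) by blast
        then obtain z where z: "\<And>n. z n \<in> topspace X" "\<And>n. e (z n) \<in> T" "\<And>n. e (z n) \<in> V n"
          by (metis IntE)
        have zC: "f (z n) \<in> f ` C" for n
          using z(1,2)[of n] ST(5) eB unfolding C_def disjnt_iff by blast
        have "limitin mtopology (\<lambda>n. f (z n)) y sequentially"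
          unfolding limitin_metric eventually_sequentially
        proof (intro conjI allI impI yM)
          fix \<epsilon> :: real assume "0 < \<epsilon>"
          then obtain N where N: "\<And>n. N \<le> n \<Longrightarrow> d (f (x n)) y < \<epsilon> / 2"
            using y unfolding limitin_metric eventually_sequentially by (meson half_gt_zero)
          obtain k where k: "inverse (Suc k) < \<epsilon> / 2"
            using reals_Archimedean[of "\<epsilon> / 2"] \<open>0 < \<epsilon>\<close> by auto
          have "f (z n) \<in> M \<and> d (f (z n)) y < \<epsilon>" if n: "max N k \<le> n" for n
          proof -
            have "d (f (z n)) (f (x n)) < inverse (Suc k)"
              using n by (intro close[OF z(1) x(1) z(3) x(2)]) auto
            moreover have "d (f (x n)) y < \<epsilon> / 2" using n by (intro N) simp
            moreover have "d (f (z n)) y \<le> d (f (z n)) (f (x n)) + d (f (x n)) y"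
              using fM x(1) z(1) yM by (intro triangle) auto
            ultimately show ?thesis using k fM[OF z(1)] by auto
          qed
          then show "\<exists>N. \<forall>n\<ge>N. f (z n) \<in> M \<and> d (f (z n)) y < \<epsilon>" by blast
        qed
        then have "y \<in> f ` C"
          by (rule limitin_closedin[OF _ closed]) (use zC in auto)
        then show False using ST(3) unfolding C_def by blast
      qed
    qed
  qed
  moreover have "gdelta_in B (\<Inter>n. G n)"
    by (rule gdelta_in_Inter) (use G open_imp_gdelta_in in auto)
  ultimately show ?thesis
    using X unfolding Cech_complete_space_def B_def e_def by simp
qed

section \<open>Gyrogroups\<close>

context gyrogroup begin

abbreviation zero :: 'a ("\<zero>") where "\<zero> \<equiv> gyro_zero G (\<oplus>)"
abbreviation inv :: "'a \<Rightarrow> 'a" ("\<ominus> _" [81] 80) where "\<ominus> x \<equiv> gyro_inv G (\<oplus>) x"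

lemma zero: "\<zero> \<in> G" "a \<in> G \<Longrightarrow> \<zero> \<oplus> a = a" "a \<in> G \<Longrightarrow> a \<oplus> \<zero> = a"
  using theI'[OF ex1_identity] unfolding gyro_zero_def by auto

lemma inv:
  assumes "x \<in> G"
  shows "\<ominus> x \<in> G" "\<ominus> x \<oplus> x = \<zero>" "x \<oplus> \<ominus> x = \<zero>"
  using theI'[OF ex1_inverse[OF assms]] unfolding gyro_inv_def by auto

lemma gyr_bij: "x \<in> G \<Longrightarrow> y \<in> G \<Longrightarrow> bij_betw (gyr x y) G G"
  using gyr_automorphism unfolding gyro_automorphism_def by blast

lemma gyr_add:
  "\<lbrakk>x \<in> G; y \<in> G; a \<in> G; b \<in> G\<rbrakk> \<Longrightarrow> gyr x y (a \<oplus> b) = gyr x y a \<oplus> gyr x y b"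
  using gyr_automorphism unfolding gyro_automorphism_def by blast

lemma gyr_closed: "\<lbrakk>x \<in> G; y \<in> G; a \<in> G\<rbrakk> \<Longrightarrow> gyr x y a \<in> G"
  using gyr_bij bij_betwE by blast

lemma gyr_eq_iff:
  "\<lbrakk>x \<in> G; y \<in> G; a \<in> G; b \<in> G\<rbrakk> \<Longrightarrow> gyr x y a = gyr x y b \<longleftrightarrow> a = b"
  using gyr_bij unfolding bij_betw_def inj_on_def by blast

text \<open>Adding \<open>\<ominus> a\<close> on the left turns \<open>a \<oplus> z\<close> into
  \<open>gyr (\<ominus> a) a z\<close>, and gyrations are injective. That this gyration is the
  identity is derived later, with the help of cancellation.\<close>

lemma add_left_cancel:
  assumes "a \<in> G" "b \<in> G" "c \<in> G"
  shows "a \<oplus> b = a \<oplus> c \<longleftrightarrow> b = c"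
proof
  assume eq: "a \<oplus> b = a \<oplus> c"
  have step: "\<ominus> a \<oplus> (a \<oplus> z) = gyr (\<ominus> a) a z" if "z \<in> G" for z
    using gyr_assoc[of "\<ominus> a" a z] assms(1) that by (simp add: inv zero gyr_closed)
  have "gyr (\<ominus> a) a b = gyr (\<ominus> a) a c"
    unfolding step[OF assms(2), symmetric] step[OF assms(3), symmetric] eq ..
  then show "b = c"
    using assms by (simp only: gyr_eq_iff inv)
qed simp

lemma gyr_zero_left: "\<lbrakk>a \<in> G; z \<in> G\<rbrakk> \<Longrightarrow> gyr \<zero> a z = z"
  using gyr_assoc[of \<zero> a z] by (simp add: zero closed gyr_closed add_left_cancel)

text \<open>The left loop property identifies \<open>gyr (\<ominus> a) a\<close> with
  \<open>gyr \<zero> a\<close>, which is the identity.\<close>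

lemma inv_add_cancel:
  assumes "a \<in> G" "b \<in> G"
  shows "\<ominus> a \<oplus> (a \<oplus> b) = b"
proof -
  have "gyr (\<ominus> a) a b = b"
    using left_loop[of "\<ominus> a" a b] assms by (simp add: inv gyr_zero_left)
  then show ?thesis
    using gyr_assoc[of "\<ominus> a" a b] assms by (simp add: inv zero)
qed

lemma inv_unique: "\<lbrakk>a \<in> G; b \<in> G; a \<oplus> b = \<zero>\<rbrakk> \<Longrightarrow> b = \<ominus> a"
  by (metis inv_add_cancel inv(1) zero(3))

lemma inv_inv: "a \<in> G \<Longrightarrow> \<ominus> (\<ominus> a) = a"
  by (metis inv inv_unique)

lemma inv_zero: "\<ominus> \<zero> = \<zero>"
  by (metis inv_unique zero)

lemma add_inv_cancel: "\<lbrakk>a \<in> G; b \<in> G\<rbrakk> \<Longrightarrow> a \<oplus> (\<ominus> a \<oplus> b) = b"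
  by (metis inv_add_cancel inv(1) inv_inv)

lemma gyr_fix_zero:
  assumes "x \<in> G" "y \<in> G"
  shows "gyr x y \<zero> = \<zero>"
proof -
  have "gyr x y \<zero> \<oplus> gyr x y \<zero> = gyr x y \<zero> \<oplus> \<zero>"
    using gyr_add[of x y \<zero> \<zero>] assms by (simp add: zero gyr_closed)
  then show ?thesis
    using assms by (simp only: add_left_cancel zero(1) gyr_closed)
qed

lemma gyr_inv: "\<lbrakk>x \<in> G; y \<in> G; z \<in> G\<rbrakk> \<Longrightarrow> gyr x y (\<ominus> z) = \<ominus> (gyr x y z)"
  by (rule inv_unique) (auto simp: gyr_closed inv gyr_fix_zero simp flip: gyr_add)

text \<open>The substitute for the group identity behind the triangle inequality; the gyration on
  the second summand is absorbed by invariant neighbourhoods.\<close>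

lemma gyr_chain:
  assumes "a \<in> G" "b \<in> G" "c \<in> G"
  shows "(\<ominus> a \<oplus> b) \<oplus> gyr (\<ominus> a) b (\<ominus> b \<oplus> c) = \<ominus> a \<oplus> c"
  using gyr_assoc[of "\<ominus> a" b "\<ominus> b \<oplus> c"] assms by (simp add: inv closed add_inv_cancel)

text \<open>The case \<open>c = a\<close> of \<open>gyr_chain\<close>, where the sum is
  \<open>\<zero>\<close>. It makes the entourages symmetric.\<close>

lemma gyr_swap:
  assumes "a \<in> G" "b \<in> G"
  shows "gyr (\<ominus> a) b (\<ominus> b \<oplus> a) = \<ominus> (\<ominus> a \<oplus> b)"
  using gyr_chain[of a b a] assms by (intro inv_unique) (auto simp: inv closed gyr_closed)

lemma gyr_image_mem_iff:
  assumes "gyr x y ` U = U" "U \<subseteq> G" "x \<in> G" "y \<in> G" "z \<in> G"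
  shows "gyr x y z \<in> U \<longleftrightarrow> z \<in> U"
  using assms gyr_eq_iff by (smt (verit, best) image_iff subsetD)

text \<open>The definition gives H its own identity, inverses and gyr map. Cancellation in G forces
  the identity, and then the inverses, to be those of G.\<close>

lemma subgyrogroup_zero_inv:
  assumes "subgyrogroup G (\<oplus>) gyr H"
  shows "\<zero> \<in> H" "h \<in> H \<Longrightarrow> \<ominus> h \<in> H" "\<lbrakk>h \<in> H; k \<in> H\<rbrakk> \<Longrightarrow> h \<oplus> k \<in> H"
proof -
  obtain gyr' where "gyrogroup H (\<oplus>) gyr'" and HG: "H \<subseteq> G"
    using assms unfolding subgyrogroup_def by blast
  then interpret H: gyrogroup H "(\<oplus>)" gyr' by simp
  have e: "H.zero = \<zero>"
    using H.zero(1) H.zero(2)[OF H.zero(1)] HG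
    by (metis add_left_cancel subsetD zero(1,3))
  then show "\<zero> \<in> H" using H.zero(1) by simp
  show "\<ominus> h \<in> H" if "h \<in> H" for h
    using H.inv[OF that] e HG that by (metis inv_unique subsetD)
  show "h \<oplus> k \<in> H" if "h \<in> H" "k \<in> H" for h k
    using H.closed that by blast
qed

text \<open>Invariance under all gyrations of G lets the ambient \<open>gyr\<close> serve as the gyr
  map of H.\<close>

lemma L_subgyrogroupI:
  assumes HG: "H \<subseteq> G" and zero: "\<zero> \<in> H" and inv: "\<And>h. h \<in> H \<Longrightarrow> \<ominus> h \<in> H"
    and add: "\<And>h k. \<lbrakk>h \<in> H; k \<in> H\<rbrakk> \<Longrightarrow> h \<oplus> k \<in> H"
    and gyr: "\<And>x y. \<lbrakk>x \<in> G; y \<in> G\<rbrakk> \<Longrightarrow> gyr x y ` H = H"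
  shows "L_subgyrogroup G (\<oplus>) gyr H"
proof -
  note GH = subsetD[OF HG]
  have aut: "gyro_automorphism H (\<oplus>) (gyr x y)" if "x \<in> G" "y \<in> G" for x y
    unfolding gyro_automorphism_def
    using bij_betw_subset[OF gyr_bij[OF that] HG gyr[OF that]] gyr_add[OF that] HG by blast
  have H0: "gyro_zero H (\<oplus>) = \<zero>"
    unfolding gyro_zero_def[of H] using zero GH \<open>\<zero> \<in> H\<close>
    by (intro the_equality) (metis gyrogroup.zero(2,3) gyrogroup_axioms)+
  have "gyrogroup H (\<oplus>) gyr"
  proof
    show "\<exists>!e. e \<in> H \<and> (\<forall>a\<in>H. e \<oplus> a = a \<and> a \<oplus> e = a)"
      using \<open>\<zero> \<in> H\<close> GH by (metis gyrogroup.zero(2,3) gyrogroup_axioms)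
    show "\<exists>!y. y \<in> H \<and> y \<oplus> x = gyro_zero H (\<oplus>) \<and> x \<oplus> y = gyro_zero H (\<oplus>)" if "x \<in> H" for x
      unfolding H0
    proof (intro ex1I[of _ "\<ominus> x"] conjI)
      show "\<ominus> x \<in> H" using that by (rule inv)
      show "\<ominus> x \<oplus> x = \<zero>" "x \<oplus> \<ominus> x = \<zero>"
        using gyrogroup.inv(2,3)[OF gyrogroup_axioms GH[OF that]] by auto
      show "y = \<ominus> x" if "y \<in> H \<and> y \<oplus> x = \<zero> \<and> x \<oplus> y = \<zero>" for y
        using inv_unique[of x y] that GH \<open>x \<in> H\<close> by blast
    qed
  qed (use \<open>\<zero> \<in> H\<close> GH add aut gyr_assoc left_loop in auto)
  then show ?thesis
    unfolding L_subgyrogroup_def subgyrogroup_def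
    using \<open>\<zero> \<in> H\<close> HG aut[OF GH GH] gyr[OF _ GH] by (intro conjI ballI exI) auto
qed

lemma left_coset_eq:
  assumes H: "L_subgyrogroup G (\<oplus>) gyr H" and a: "a \<in> G" and x: "x \<in> left_coset (\<oplus>) H a"
  shows "left_coset (\<oplus>) H x = left_coset (\<oplus>) H a"
proof -
  have HG: "H \<subseteq> G" and sub: "subgyrogroup G (\<oplus>) gyr H"
    using H unfolding L_subgyrogroup_def subgyrogroup_def by auto
  note sg = subgyrogroup_zero_inv[OF sub]
  obtain h where h: "h \<in> H" "x = a \<oplus> h"
    using x unfolding left_coset_def by blast
  have "left_coset (\<oplus>) H x = (\<oplus>) (a \<oplus> h) ` (gyr a h ` H)"
    using H a h unfolding L_subgyrogroup_def left_coset_def by simp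
  also have "\<dots> = (\<lambda>k. a \<oplus> (h \<oplus> k)) ` H"
    unfolding image_image using gyr_assoc[OF a, of h] h HG by (intro image_cong) (auto simp: subset_iff)
  also have "\<dots> = (\<oplus>) a ` ((\<oplus>) h ` H)"
    by (simp add: image_image)
  also have "(\<oplus>) h ` H = H"
  proof
    show "H \<subseteq> (\<oplus>) h ` H"
    proof
      fix k assume "k \<in> H"
      then have "k = h \<oplus> (\<ominus> h \<oplus> k)" "\<ominus> h \<oplus> k \<in> H"
        using h(1) sg add_inv_cancel[of h k] HG by (auto simp: subset_iff)
      then show "k \<in> (\<oplus>) h ` H" by blast
    qed
  qed (use h sg in auto)
  finally show ?thesis unfolding left_coset_def .
qed

lemma mem_left_coset_self:
  assumes "L_subgyrogroup G (\<oplus>) gyr H" "a \<in> G"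
  shows "a \<in> left_coset (\<oplus>) H a"
  using assms subgyrogroup_zero_inv(1)[of H] zero(3)[of a]
  unfolding L_subgyrogroup_def left_coset_def by force

lemma left_coset_eq_iff:
  assumes H: "L_subgyrogroup G (\<oplus>) gyr H" and "a \<in> G" "x \<in> G"
  shows "left_coset (\<oplus>) H x = left_coset (\<oplus>) H a \<longleftrightarrow> x \<in> left_coset (\<oplus>) H a"
  using left_coset_eq[OF H \<open>a \<in> G\<close>] mem_left_coset_self[OF H \<open>x \<in> G\<close>] by blast

end

section \<open>Topological gyrogroups\<close>

context topological_gyrogroup
begin

notation zero ("\<zero>") and inv ("\<ominus> _" [81] 80)

lemma continuous_map_left_translation:
  assumes "a \<in> topspace X"
  shows "continuous_map X X (\<lambda>z. a \<oplus> z)"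
proof -
  have "continuous_map X (prod_topology X X) (\<lambda>z. (a, z))"
    using assms by (simp add: continuous_map_pairwise o_def)
  from continuous_map_compose[OF this continuous_add] show ?thesis by (simp add: o_def)
qed

lemma openin_left_translation:
  "\<lbrakk>a \<in> topspace X; openin X W\<rbrakk> \<Longrightarrow> openin X {z \<in> topspace X. a \<oplus> z \<in> W}"
  using openin_continuous_map_preimage[OF continuous_map_left_translation] .

text \<open>Fibres are translates of the compact set H. For closedness, a coset missing the closed
  set \<open>A\<close> has a neighbourhood of cosets missing \<open>A\<close>, by the tube lemma
  applied to \<open>{x} \<times> H\<close>.\<close>

lemma proper_map_left_coset:
  assumes H: "L_subgyrogroup (topspace X) (\<oplus>) gyr H" and compact: "compactin X H"
  shows "proper_map X (coset_space X (\<oplus>) H) (left_coset (\<oplus>) H)"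
proof -
  let ?p = "left_coset (\<oplus>) H"
  have HG: "H \<subseteq> topspace X" using compact by (rule compactin_subset_topspace)
  have sub: "?p x \<subseteq> topspace X" if "x \<in> topspace X" for x
    unfolding left_coset_def using that HG closed by blast
  have eq_iff: "?p x = ?p a \<longleftrightarrow> x \<in> ?p a" if "a \<in> topspace X" "x \<in> topspace X" for a x
    using left_coset_eq_iff[OF H that] .
  show ?thesis
    unfolding proper_map_def
  proof
    show "closed_map X (coset_space X (\<oplus>) H) ?p"
      unfolding closed_map_def
    proof (intro allI impI)
      fix A assume A: "closedin X A"
      then have AG: "A \<subseteq> topspace X" by (rule closedin_subset)
      have set_eq: "{x \<in> topspace X. ?p x \<in> topspace (coset_space X (\<oplus>) H) - ?p ` A} =
          {x \<in> topspace X. ?p x \<subseteq> topspace X - A}"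
      proof -
        have key: "?p x \<in> ?p ` A \<longleftrightarrow> ?p x \<inter> A \<noteq> {}" if x: "x \<in> topspace X" for x
        proof
          assume "?p x \<in> ?p ` A"
          then obtain a where "a \<in> A" "?p a = ?p x" by auto
          then show "?p x \<inter> A \<noteq> {}" using eq_iff[OF x, of a] AG by blast
        next
          assume "?p x \<inter> A \<noteq> {}"
          then obtain a where "a \<in> A" "a \<in> ?p x" by blast
          then have "?p a = ?p x" using eq_iff[OF x, of a] AG by blast
          then show "?p x \<in> ?p ` A" using \<open>a \<in> A\<close> by (metis imageI)
        qed
        have "?p x \<in> topspace (coset_space X (\<oplus>) H) - ?p ` A \<longleftrightarrow> ?p x \<subseteq> topspace X - A"
          if "x \<in> topspace X" for x
        proof -
          have "?p x \<subseteq> topspace X - A \<longleftrightarrow> ?p x \<inter> A = {}" using sub[OF that] by blast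
          then show ?thesis unfolding topspace_coset_space Diff_iff key[OF that] using that by simp
        qed
        then show ?thesis by (intro Collect_cong conj_cong refl)
      qed
      have "openin X {x \<in> topspace X. ?p x \<subseteq> topspace X - A}"
      proof (subst openin_subopen, clarify)
        fix x assume x: "x \<in> topspace X" "?p x \<subseteq> topspace X - A"
        let ?W = "{q \<in> topspace (prod_topology X X). (\<lambda>(x, y). x \<oplus> y) q \<in> topspace X - A}"
        have 1: "openin (prod_topology X X) ?W"
          using continuous_add openin_diff[OF openin_topspace A] by (rule openin_continuous_map_preimage)
        have 2: "{x} \<times> H \<subseteq> ?W"
          using x HG unfolding left_coset_def by auto
        obtain U V where UV: "openin X U" "x \<in> U" "H \<subseteq> V" "U \<times> V \<subseteq> ?W"
          using tube_lemma_right[OF 1 compact x(1) 2] by (elim exE conjE)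
        have "?p u \<subseteq> topspace X - A" if "u \<in> U" for u
        proof
          fix z assume "z \<in> ?p u"
          then obtain h where "h \<in> H" "z = u \<oplus> h" unfolding left_coset_def by blast
          then have "(u, h) \<in> ?W" using UV that by blast
          then show "z \<in> topspace X - A" using \<open>z = u \<oplus> h\<close> by simp
        qed
        then have "U \<subseteq> {x \<in> topspace X. ?p x \<subseteq> topspace X - A}"
          using openin_subset[OF UV(1)] by blast
        then show "\<exists>T. openin X T \<and> x \<in> T \<and> T \<subseteq> {x \<in> topspace X. ?p x \<subseteq> topspace X - A}"
          using UV by blast
      qed
      then have "openin (coset_space X (\<oplus>) H) (topspace (coset_space X (\<oplus>) H) - ?p ` A)"
        unfolding openin_coset_space set_eq[symmetric] by (simp add: topspace_coset_space)
      then show "closedin (coset_space X (\<oplus>) H) (?p ` A)"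
        unfolding closedin_def topspace_coset_space using AG by blast
    qed
    show "\<forall>y\<in>topspace (coset_space X (\<oplus>) H). compactin X {x \<in> topspace X. ?p x = y}"
      unfolding topspace_coset_space
    proof clarify
      fix a assume a: "a \<in> topspace X"
      have "{x \<in> topspace X. ?p x = ?p a} = ?p a"
        using eq_iff[OF a] sub[OF a] by blast
      then have "{x \<in> topspace X. ?p x = ?p a} = (\<lambda>h. a \<oplus> h) ` H"
        by (simp add: left_coset_def)
      then show "compactin X {x \<in> topspace X. ?p x = ?p a}"
        using image_compactin[OF compact continuous_map_left_translation[OF a]] by simp
    qed
  qed
qed

end

section \<open>Invariant neighbourhoods and the pseudometrics that they generate\<close>

context strongly_topological_gyrogroup
begin

notation zero ("\<zero>") and inv ("\<ominus> _" [81] 80)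

definition gyr_nbhd :: "'a set \<Rightarrow> bool" where
  "gyr_nbhd U \<longleftrightarrow> U \<subseteq> topspace X \<and> (\<exists>V. openin X V \<and> \<zero> \<in> V \<and> V \<subseteq> U) \<and>
     (\<forall>x\<in>topspace X. \<forall>y\<in>topspace X. \<forall>z\<in>topspace X. gyr x y z \<in> U \<longleftrightarrow> z \<in> U) \<and>
     (\<forall>u\<in>U. \<ominus> u \<in> U)"

lemma gyr_nbhd_zero: "gyr_nbhd U \<Longrightarrow> \<zero> \<in> U"
  unfolding gyr_nbhd_def by blast

text \<open>Intersecting an invariant \<open>U\<close> with its set of inverses makes it symmetric;
  invariance survives because gyrations commute with inversion.\<close>

lemma ex_gyr_nbhd:
  assumes "openin X W" "\<zero> \<in> W"
  obtains U where "gyr_nbhd U" "U \<subseteq> W"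
proof -
  obtain U V where U: "U \<subseteq> topspace X" "openin X V" "\<zero> \<in> V" "V \<subseteq> U" "U \<subseteq> W"
    and gyr: "\<And>x y. \<lbrakk>x \<in> topspace X; y \<in> topspace X\<rbrakk> \<Longrightarrow> gyr x y ` U = U"
    using gyr_invariant_base assms by metis
  let ?U = "U \<inter> {u \<in> topspace X. \<ominus> u \<in> U}"
  have "openin X (V \<inter> {u \<in> topspace X. \<ominus> u \<in> V})"
    using U(2) openin_continuous_map_preimage[OF continuous_inv U(2)] by (rule openin_Int)
  moreover have "\<zero> \<in> V \<inter> {u \<in> topspace X. \<ominus> u \<in> V}" using U by (simp add: zero inv_zero)
  moreover have "V \<inter> {u \<in> topspace X. \<ominus> u \<in> V} \<subseteq> ?U" using U by blast
  moreover have "gyr x y z \<in> ?U \<longleftrightarrow> z \<in> ?U"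
    if "x \<in> topspace X" "y \<in> topspace X" "z \<in> topspace X" for x y z
    using gyr_image_mem_iff[OF gyr U(1)] that by (simp add: gyr_closed inv flip: gyr_inv)
  moreover have "\<ominus> u \<in> ?U" if "u \<in> ?U" for u
    using that by (auto simp: inv inv_inv)
  ultimately have "gyr_nbhd ?U" unfolding gyr_nbhd_def by blast
  then show thesis using U(5) by (intro that[of ?U]) auto
qed

lemma ex_gyr_nbhd_add:
  assumes "gyr_nbhd U"
  obtains V where "openin X V" "\<zero> \<in> V" "\<And>a b. \<lbrakk>a \<in> V; b \<in> V\<rbrakk> \<Longrightarrow> a \<oplus> b \<in> U"
proof -
  obtain V where V: "openin X V" "\<zero> \<in> V" "V \<subseteq> U"
    using assms unfolding gyr_nbhd_def by blast
  let ?W = "{q \<in> topspace (prod_topology X X). (\<lambda>(x, y). x \<oplus> y) q \<in> V}"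
  have "openin (prod_topology X X) ?W"
    using continuous_add V(1) by (rule openin_continuous_map_preimage)
  moreover have "(\<zero>, \<zero>) \<in> ?W" using V(2) by (simp add: zero)
  ultimately obtain A B where AB: "openin X A" "openin X B" "\<zero> \<in> A" "\<zero> \<in> B" "A \<times> B \<subseteq> ?W"
    unfolding openin_prod_topology_alt by meson
  show thesis
  proof
    show "openin X (A \<inter> B)" "\<zero> \<in> A \<inter> B" using AB by auto
    show "a \<oplus> b \<in> U" if "a \<in> A \<inter> B" "b \<in> A \<inter> B" for a b
    proof -
      have "(a, b) \<in> ?W" using AB(5) that by blast
      then show ?thesis using V(3) by auto
    qed
  qed
qed

lemma ex_gyr_nbhd_add3:
  assumes U: "gyr_nbhd U" and W: "openin X W" "\<zero> \<in> W"
  obtains V where "gyr_nbhd V" "V \<subseteq> W"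
    "\<And>a b c. \<lbrakk>a \<in> V; b \<in> V; c \<in> V\<rbrakk> \<Longrightarrow> (a \<oplus> b) \<oplus> c \<in> U"
proof -
  obtain V1 where V1: "openin X V1" "\<zero> \<in> V1" "\<And>a b. \<lbrakk>a \<in> V1; b \<in> V1\<rbrakk> \<Longrightarrow> a \<oplus> b \<in> U"
    using ex_gyr_nbhd_add[OF U] by metis
  obtain U1 where U1: "gyr_nbhd U1" "U1 \<subseteq> V1" using ex_gyr_nbhd[OF V1(1,2)] .
  obtain V2 where V2: "openin X V2" "\<zero> \<in> V2" "\<And>a b. \<lbrakk>a \<in> V2; b \<in> V2\<rbrakk> \<Longrightarrow> a \<oplus> b \<in> U1"
    using ex_gyr_nbhd_add[OF U1(1)] by metis
  obtain V where V: "gyr_nbhd V" "V \<subseteq> W \<inter> V1 \<inter> V2"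
    using ex_gyr_nbhd[of "W \<inter> V1 \<inter> V2"] W V1 V2 by blast
  show thesis
  proof (rule that[OF V(1)])
    show "V \<subseteq> W" using V(2) by blast
    show "(a \<oplus> b) \<oplus> c \<in> U" if "a \<in> V" "b \<in> V" "c \<in> V" for a b c
    proof (rule V1(3))
      show "a \<oplus> b \<in> V1" using V2(3)[of a b] V(2) U1(2) that by blast
      show "c \<in> V1" using V(2) that by blast
    qed
  qed
qed

lemma gyr_nbhd_sequence:
  assumes W: "\<And>n. openin X (W n)" "\<And>n. \<zero> \<in> W n"
  obtains U where "\<And>n. gyr_nbhd (U n)" "\<And>n. U n \<subseteq> W n"
    "\<And>n a b c. \<lbrakk>a \<in> U (Suc n); b \<in> U (Suc n); c \<in> U (Suc n)\<rbrakk> \<Longrightarrow> (a \<oplus> b) \<oplus> c \<in> U n"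
proof -
  have "\<exists>U. \<forall>n::nat. (gyr_nbhd (U n) \<and> U n \<subseteq> W n) \<and>
      (\<forall>a\<in>U (Suc n). \<forall>b\<in>U (Suc n). \<forall>c\<in>U (Suc n). (a \<oplus> b) \<oplus> c \<in> U n)"
  proof (rule dependent_nat_choice)
    show "\<exists>U. gyr_nbhd U \<and> U \<subseteq> W 0" using ex_gyr_nbhd[OF W] by metis
    show "\<exists>V. (gyr_nbhd V \<and> V \<subseteq> W (Suc n)) \<and> (\<forall>a\<in>V. \<forall>b\<in>V. \<forall>c\<in>V. (a \<oplus> b) \<oplus> c \<in> U)"
      if "gyr_nbhd U \<and> U \<subseteq> W n" for U n
      using ex_gyr_nbhd_add3[OF conjunct1[OF that] W] by metis
  qed
  then show thesis using that by blast
qed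

text \<open>Symmetry of the entourages comes from \<open>gyr_swap\<close>, composition from
  \<open>gyr_chain\<close> used twice. Continuity holds because a ball about \<open>x\<close>
  contains an open set of the form \<open>{y. \<ominus> x \<oplus> y \<in> V}\<close> around
  \<open>x\<close>.\<close>

lemma gyr_nbhd_pseudometric:
  assumes U: "\<And>n. gyr_nbhd (U n)"
    and U3: "\<And>n a b c. \<lbrakk>a \<in> U (Suc n); b \<in> U (Suc n); c \<in> U (Suc n)\<rbrakk> \<Longrightarrow> (a \<oplus> b) \<oplus> c \<in> U n"
  obtains d :: "'a \<Rightarrow> 'a \<Rightarrow> real" where
    "\<And>x y. 0 \<le> d x y" "\<And>x. d x x = 0" "\<And>x y. d x y = d y x"
    "\<And>x y z. d x z \<le> d x y + d y z"
    "\<And>n x y. \<lbrakk>x \<in> topspace X; y \<in> topspace X; \<ominus> x \<oplus> y \<in> U n\<rbrakk> \<Longrightarrow> d x y \<le> (1/2) ^ Suc n"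
    "\<And>n x y. \<lbrakk>x \<in> topspace X; y \<in> topspace X; d x y < (1/2) ^ Suc n\<rbrakk> \<Longrightarrow> \<ominus> x \<oplus> y \<in> U n"
    "\<And>x. x \<in> topspace X \<Longrightarrow> continuous_map X euclideanreal (d x)"
proof -
  \<comment> \<open>The metrization lemma asks for reflexivity on the whole type; outside the
    carrier the relation is equality.\<close>
  define E where "E n x y \<longleftrightarrow> x = y \<or> x \<in> topspace X \<and> y \<in> topspace X \<and> \<ominus> x \<oplus> y \<in> U n" for n x y
  have E: "E n x y \<longleftrightarrow> \<ominus> x \<oplus> y \<in> U n" if "x \<in> topspace X" "y \<in> topspace X" for n x y
    unfolding E_def using that gyr_nbhd_zero[OF U] by (auto simp: inv)
  have gyr_iff: "gyr x y z \<in> U n \<longleftrightarrow> z \<in> U n"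
    if "x \<in> topspace X" "y \<in> topspace X" "z \<in> topspace X" for x y z n
    using U[of n] that unfolding gyr_nbhd_def by blast
  have E_sym: "E n y x" if "E n x y" for n x y
  proof (cases "x \<in> topspace X \<and> y \<in> topspace X")
    case True
    then have "\<ominus> (\<ominus> x \<oplus> y) \<in> U n"
      using that U[of n] E unfolding gyr_nbhd_def by blast
    then have "\<ominus> y \<oplus> x \<in> U n"
      using gyr_iff[of "\<ominus> x" y "\<ominus> y \<oplus> x" n] True by (simp add: gyr_swap inv closed)
    then show ?thesis using E True by blast
  qed (use that in \<open>auto simp: E_def\<close>)
  have E_comp: "E n w z" if "E (Suc n) w x" "E (Suc n) x y" "E (Suc n) y z" for n w x y z
  proof (cases "w \<in> topspace X")
    case True
    then have top: "x \<in> topspace X" "y \<in> topspace X" "z \<in> topspace X"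
      using that unfolding E_def by auto
    have "\<ominus> w \<oplus> z = (\<ominus> w \<oplus> y) \<oplus> gyr (\<ominus> w) y (\<ominus> y \<oplus> z)"
      using gyr_chain True top by simp
    also have "\<ominus> w \<oplus> y = (\<ominus> w \<oplus> x) \<oplus> gyr (\<ominus> w) x (\<ominus> x \<oplus> y)"
      using gyr_chain True top by simp
    finally have "\<ominus> w \<oplus> z \<in> U n"
      using U3[of "\<ominus> w \<oplus> x" n] that E True top gyr_iff by (simp add: inv closed)
    then show ?thesis using E True top by blast
  qed (use that in \<open>auto simp: E_def\<close>)
  obtain d :: "'a \<Rightarrow> 'a \<Rightarrow> real" where d: "\<And>x y. 0 \<le> d x y" "\<And>x. d x x = 0" "\<And>x y. d x y = d y x"
    "\<And>x y z. d x z \<le> d x y + d y z"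
    and dE: "\<And>n x y. E n x y \<Longrightarrow> d x y \<le> (1/2) ^ Suc n" "\<And>n x y. d x y < (1/2) ^ Suc n \<Longrightarrow> E n x y"
    by (rule pseudometric_from_entourages[of E]) (auto simp: E_def[of _ x x for x] intro: E_sym E_comp)
  have small: "\<exists>T. openin X T \<and> x \<in> T \<and> (\<forall>y\<in>T. d x y < e)" if x: "x \<in> topspace X" and e: "0 < e" for x e
  proof -
    obtain n where n: "(1/2) ^ n < e" using real_arch_pow_inv[OF e, of "1/2"] by auto
    obtain V where V: "openin X V" "\<zero> \<in> V" "V \<subseteq> U n" using U[of n] unfolding gyr_nbhd_def by blast
    let ?T = "{y \<in> topspace X. \<ominus> x \<oplus> y \<in> V}"
    have "d x y < e" if "y \<in> ?T" for y
    proof -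
      have "d x y \<le> (1/2) ^ Suc n" using that V E[OF x] by (intro dE(1)) auto
      also have "\<dots> \<le> (1/2) ^ n" by simp
      finally show ?thesis using n by simp
    qed
    moreover have "openin X ?T" using inv(1)[OF x] V(1) by (rule openin_left_translation)
    moreover have "x \<in> ?T" using x V(2) by (simp add: inv)
    ultimately show ?thesis by blast
  qed
  have cont: "continuous_map X euclideanreal (d x)" for x
    unfolding continuous_map_def
  proof (intro conjI allI impI)
    fix V :: "real set" assume "openin euclideanreal V"
    then have V: "open V" by simp
    show "openin X {y \<in> topspace X. d x y \<in> V}"
    proof (subst openin_subopen, clarify)
      fix y assume y: "y \<in> topspace X" "d x y \<in> V"
      obtain e where e: "0 < e" "\<And>t. \<bar>t - d x y\<bar> < e \<Longrightarrow> t \<in> V"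
        using V y(2) unfolding open_dist dist_real_def by metis
      obtain T where T: "openin X T" "y \<in> T" "\<forall>z\<in>T. d y z < e" using small[OF y(1) e(1)] by blast
      have "\<bar>d x z - d x y\<bar> < e" if "z \<in> T" for z
        using T(3) that d(4)[of x z y] d(4)[of x y z] d(3)[of y z] by fastforce
      then have "T \<subseteq> {y \<in> topspace X. d x y \<in> V}"
        using e(2) openin_subset[OF T(1)] by blast
      then show "\<exists>T. openin X T \<and> y \<in> T \<and> T \<subseteq> {y \<in> topspace X. d x y \<in> V}"
        using T by blast
    qed
  qed simp
  show thesis
  proof (rule that[of d, OF d _ _ cont])
    show "d x y \<le> (1/2) ^ Suc n" if "x \<in> topspace X" "y \<in> topspace X" "\<ominus> x \<oplus> y \<in> U n" for n x y
      using dE(1)[of n x y] E[of x y n] that by blast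
    show "\<ominus> x \<oplus> y \<in> U n" if "x \<in> topspace X" "y \<in> topspace X" "d x y < (1/2) ^ Suc n" for n x y
      using dE(2)[of x y n] E[of x y n] that by blast
  qed
qed

text \<open>A separating function is built from the distance to \<open>x\<close>, for a sequence of
  neighbourhoods that all lie in the translate of the complement of \<open>S\<close>.\<close>

lemma completely_regular_space: "completely_regular_space X"
  unfolding completely_regular_space_def
proof (intro allI impI, elim conjE)
  fix S x assume S: "closedin X S" and x: "x \<in> topspace X - S"
  let ?W = "{z \<in> topspace X. x \<oplus> z \<in> topspace X - S}"
  have W: "openin X ?W"
    using x openin_diff[OF openin_topspace S] by (intro openin_left_translation) auto
  have W0: "\<zero> \<in> ?W" using x by (simp add: zero)
  obtain U where U: "\<And>n::nat. gyr_nbhd (U n)" "\<And>n. U n \<subseteq> ?W"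
    "\<And>n a b c. \<lbrakk>a \<in> U (Suc n); b \<in> U (Suc n); c \<in> U (Suc n)\<rbrakk> \<Longrightarrow> (a \<oplus> b) \<oplus> c \<in> U n"
    by (rule gyr_nbhd_sequence[of "\<lambda>_. ?W", OF W W0], rule that)
  obtain d :: "'a \<Rightarrow> 'a \<Rightarrow> real" where d: "\<And>x y. 0 \<le> d x y" "\<And>x. d x x = 0"
      "\<And>x y. d x y = d y x" "\<And>x y z. d x z \<le> d x y + d y z"
    and dU: "\<And>n x y. \<lbrakk>x \<in> topspace X; y \<in> topspace X; \<ominus> x \<oplus> y \<in> U n\<rbrakk> \<Longrightarrow> d x y \<le> (1/2) ^ Suc n"
    and Ud: "\<And>n x y. \<lbrakk>x \<in> topspace X; y \<in> topspace X; d x y < (1/2) ^ Suc n\<rbrakk> \<Longrightarrow> \<ominus> x \<oplus> y \<in> U n"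
    and cont: "\<And>x. x \<in> topspace X \<Longrightarrow> continuous_map X euclideanreal (d x)"
    by (rule gyr_nbhd_pseudometric[OF U(1,3)], assumption+, rule that)
  \<comment> \<open>The bound is \<open>(1/2) ^ Suc 0\<close>: closer points differ from
    \<open>x\<close> by an element of \<open>U 0\<close>, so they miss \<open>S\<close>. This
    explains the factor 2 in \<open>?f\<close>.\<close>
  have far: "1/2 \<le> d x y" if y: "y \<in> S" for y
  proof (rule ccontr)
    assume "\<not> 1/2 \<le> d x y"
    moreover have "y \<in> topspace X" using y closedin_subset[OF S] by blast
    ultimately have "\<ominus> x \<oplus> y \<in> ?W" "x \<oplus> (\<ominus> x \<oplus> y) = y"
      using Ud[of x y 0] U(2)[of 0] x by (auto simp: add_inv_cancel)
    then show False using y by simp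
  qed
  let ?f = "\<lambda>y. min 1 (2 * d x y)"
  have "continuous_map X euclideanreal ?f"
    using cont[of x] x by (intro continuous_map_real_min continuous_map_real_mult) auto
  then have "continuous_map X (top_of_set {0..1}) ?f"
    using d(1) by (auto simp: continuous_map_in_subtopology)
  moreover have "?f x = 0" "?f ` S \<subseteq> {1}" using d(2) far by fastforce+
  ultimately show "\<exists>f::'a \<Rightarrow> real. continuous_map X (top_of_set {0..1}) f \<and> f x = 0 \<and> f ` S \<subseteq> {1}"
    by blast
qed

text \<open>By \<open>d0\<close> the pseudometric descends to cosets. Continuity of \<open>d\<close>
  makes metrically open sets open in the quotient; \<open>base\<close> gives the converse.\<close>

lemma metrizable_coset_space:
  assumes d: "\<And>x y. 0 \<le> d x y" "\<And>x. d x x = (0::real)" "\<And>x y. d x y = d y x"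
    "\<And>x y z. d x z \<le> d x y + d y z"
    and cont: "\<And>x. x \<in> topspace X \<Longrightarrow> continuous_map X euclideanreal (d x)"
    and H: "L_subgyrogroup (topspace X) (\<oplus>) gyr H"
    and d0: "\<And>x y. \<lbrakk>x \<in> topspace X; y \<in> topspace X\<rbrakk> \<Longrightarrow> d x y = 0 \<longleftrightarrow> \<ominus> x \<oplus> y \<in> H"
    and base: "\<And>T. \<lbrakk>openin X T; H \<subseteq> T\<rbrakk> \<Longrightarrow>
      \<exists>e>0. \<forall>x\<in>topspace X. \<forall>y\<in>topspace X. d x y < e \<longrightarrow> \<ominus> x \<oplus> y \<in> T"
  shows "metrizable_space (coset_space X (\<oplus>) H)"
proof -
  let ?G = "topspace X" and ?p = "left_coset (\<oplus>) H"
  have HG: "H \<subseteq> ?G" using H unfolding L_subgyrogroup_def subgyrogroup_def by blast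
  have mem: "y \<in> ?p x \<longleftrightarrow> d x y = 0" if "x \<in> ?G" "y \<in> ?G" for x y
  proof
    assume "y \<in> ?p x"
    then show "d x y = 0"
      using that d0 HG inv_add_cancel unfolding left_coset_def by auto
  next
    assume "d x y = 0"
    then have "\<ominus> x \<oplus> y \<in> H" "y = x \<oplus> (\<ominus> x \<oplus> y)" using that d0 by (auto simp: add_inv_cancel)
    then show "y \<in> ?p x" unfolding left_coset_def by blast
  qed
  have p_eq: "?p y = ?p x \<longleftrightarrow> d x y = 0" if "x \<in> ?G" "y \<in> ?G" for x y
    using left_coset_eq_iff[OF H that] mem[OF that] by simp
  define rep where "rep A = (SOME x. x \<in> ?G \<and> ?p x = A)" for A
  define D where "D A B = d (rep A) (rep B)" for A B
  have rep: "rep (?p x) \<in> ?G" "?p (rep (?p x)) = ?p x" if "x \<in> ?G" for x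
    using someI[of "\<lambda>z. z \<in> ?G \<and> ?p z = ?p x" x] that unfolding rep_def by auto
  have D: "D (?p x) (?p y) = d x y" if "x \<in> ?G" "y \<in> ?G" for x y
  proof -
    have "d x (rep (?p x)) = 0" "d y (rep (?p y)) = 0"
      using p_eq rep that by blast+
    then show ?thesis
      unfolding D_def
      using d(4)[of "rep (?p x)" y x] d(4)[of "rep (?p x)" y "rep (?p y)"]
        d(4)[of "rep (?p x)" "rep (?p y)" y] d(4)[of x y "rep (?p x)"]
        d(3)[of x "rep (?p x)"] d(3)[of y "rep (?p y)"]
      by linarith
  qed
  interpret M: Metric_space "?p ` ?G" D
  proof
    show "0 \<le> D A B" "D A B = D B A" for A B unfolding D_def using d by auto
    show "D A B = 0 \<longleftrightarrow> A = B" if AB: "A \<in> ?p ` ?G" "B \<in> ?p ` ?G" for A B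
    proof -
      obtain x y where "x \<in> ?G" "A = ?p x" "y \<in> ?G" "B = ?p y" using AB by blast
      then show ?thesis using D[of x y] p_eq[of x y] by metis
    qed
    show "D A C \<le> D A B + D B C" for A B C
      unfolding D_def by (rule d(4))
  qed
  have "openin M.mtopology \<W> \<longleftrightarrow> openin (coset_space X (\<oplus>) H) \<W>" for \<W>
  proof
    assume \<W>: "openin M.mtopology \<W>"
    have "openin X {x \<in> ?G. ?p x \<in> \<W>}"
    proof (subst openin_subopen, clarify)
      fix x assume x: "x \<in> ?G" "?p x \<in> \<W>"
      then obtain r where r: "0 < r" "M.mball (?p x) r \<subseteq> \<W>"
        using \<W> unfolding M.openin_mtopology by blast
      have "openin X {y \<in> ?G. d x y \<in> {..<r}}"
        by (rule openin_continuous_map_preimage[OF cont[OF x(1)]]) simp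
      moreover have "{y \<in> ?G. d x y \<in> {..<r}} \<subseteq> {x \<in> ?G. ?p x \<in> \<W>}"
      proof
        fix y assume y: "y \<in> {y \<in> ?G. d x y \<in> {..<r}}"
        then have "?p y \<in> M.mball (?p x) r" using x D by simp
        then show "y \<in> {x \<in> ?G. ?p x \<in> \<W>}" using r y by blast
      qed
      ultimately show "\<exists>T. openin X T \<and> x \<in> T \<and> T \<subseteq> {x \<in> ?G. ?p x \<in> \<W>}"
        using x r d(2) by (intro exI[of _ "{y \<in> ?G. d x y \<in> {..<r}}"]) auto
    qed
    then show "openin (coset_space X (\<oplus>) H) \<W>"
      using \<W> unfolding openin_coset_space M.openin_mtopology by blast
  next
    assume "openin (coset_space X (\<oplus>) H) \<W>"
    then have \<W>: "\<W> \<subseteq> ?p ` ?G" "openin X {x \<in> ?G. ?p x \<in> \<W>}"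
      unfolding openin_coset_space by auto
    show "openin M.mtopology \<W>"
      unfolding M.openin_mtopology
    proof (intro conjI allI impI \<W>(1))
      fix A assume A: "A \<in> \<W>"
      then obtain x where x: "x \<in> ?G" "A = ?p x" using \<W>(1) by blast
      \<comment> \<open>Translating by \<open>x\<close> moves the saturated open set around
        \<open>x \<oplus> H\<close> to one around H, the only place where \<open>base\<close>
        speaks.\<close>
      let ?T = "{z \<in> ?G. x \<oplus> z \<in> {x \<in> ?G. ?p x \<in> \<W>}}"
      have "openin X ?T" using x(1) \<W>(2) by (rule openin_left_translation)
      moreover have "H \<subseteq> ?T"
      proof
        fix h assume h: "h \<in> H"
        then have "x \<oplus> h \<in> ?p x" unfolding left_coset_def by blast
        then have "?p (x \<oplus> h) = ?p x" by (rule left_coset_eq[OF H x(1)])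
        then show "h \<in> ?T" using h HG x A closed by auto
      qed
      ultimately obtain e where e: "0 < e"
        "\<And>x y. \<lbrakk>x \<in> ?G; y \<in> ?G; d x y < e\<rbrakk> \<Longrightarrow> \<ominus> x \<oplus> y \<in> ?T"
        using base by meson
      have "M.mball A e \<subseteq> \<W>"
      proof
        fix B assume "B \<in> M.mball A e"
        then obtain y where y: "y \<in> ?G" "B = ?p y" "d x y < e" using x D by auto
        then have "\<ominus> x \<oplus> y \<in> ?T" "x \<oplus> (\<ominus> x \<oplus> y) = y"
          using e(2)[of x y] x by (auto simp: add_inv_cancel)
        then show "B \<in> \<W>" using y by simp
      qed
      then show "\<exists>r>0. M.mball A r \<subseteq> \<W>" using e(1) by blast
    qed
  qed
  then have "M.mtopology = coset_space X (\<oplus>) H" by (simp add: topology_eq)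
  then show ?thesis using M.metrizable_space_mtopology by simp
qed

text \<open>The compact set of the definition need not contain \<open>\<zero>\<close>; left
  translation by \<open>\<ominus> k\<close>, with \<open>k\<close> one of its points and inverse
  translation by \<open>k\<close>, moves it and its base there.\<close>

lemma feathered_at_zero:
  assumes "feathered X"
  obtains K W where "compactin X K" "\<zero> \<in> K" "\<And>n::nat. openin X (W n)" "\<And>n. K \<subseteq> W n"
    "\<And>T. \<lbrakk>openin X T; K \<subseteq> T\<rbrakk> \<Longrightarrow> \<exists>n. W n \<subseteq> T"
proof -
  let ?G = "topspace X"
  obtain K where K: "K \<noteq> {}" "compactin X K" "countable_character_in X K"
    using assms unfolding feathered_def by (elim exE conjE)
  obtain \<V> where "countable \<V>" "\<forall>V\<in>\<V>. openin X V \<and> K \<subseteq> V"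
    "\<forall>T. openin X T \<and> K \<subseteq> T \<longrightarrow> (\<exists>V\<in>\<V>. V \<subseteq> T)"
    using K(3) unfolding countable_character_in_def by (elim exE conjE)
  then have \<V>: "countable \<V>" "\<And>V. V \<in> \<V> \<Longrightarrow> openin X V \<and> K \<subseteq> V"
    "\<And>T. \<lbrakk>openin X T; K \<subseteq> T\<rbrakk> \<Longrightarrow> \<exists>V\<in>\<V>. V \<subseteq> T"
    by simp_all
  have KG: "K \<subseteq> ?G" using K(2) by (rule compactin_subset_topspace)
  obtain k where k: "k \<in> K" "k \<in> ?G" using K(1) KG by blast
  have "\<V> \<noteq> {}" using \<V>(3)[OF openin_topspace KG] by blast
  then have range: "range (from_nat_into \<V>) = \<V>" using \<V>(1) by (rule range_from_nat_into)
  define W where "W n = {z \<in> ?G. k \<oplus> z \<in> from_nat_into \<V> n}" for n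
  have V: "openin X (from_nat_into \<V> n)" "K \<subseteq> from_nat_into \<V> n" for n
    using \<V>(2) from_nat_into[OF \<open>\<V> \<noteq> {}\<close>] by blast+
  show thesis
  proof
    show "compactin X ((\<lambda>z. \<ominus> k \<oplus> z) ` K)"
      using K(2) continuous_map_left_translation[OF inv(1)[OF k(2)]] by (rule image_compactin)
    show "\<zero> \<in> (\<lambda>z. \<ominus> k \<oplus> z) ` K"
      using k inv(2)[OF k(2)] by (metis imageI)
    show "openin X (W n)" for n unfolding W_def using k(2) V(1) by (rule openin_left_translation)
    show "(\<lambda>z. \<ominus> k \<oplus> z) ` K \<subseteq> W n" for n
      unfolding W_def using V(2)[of n] KG k by (auto simp: closed inv add_inv_cancel subset_iff)
    fix T assume T: "openin X T" "(\<lambda>z. \<ominus> k \<oplus> z) ` K \<subseteq> T"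
    have 1: "openin X {z \<in> ?G. \<ominus> k \<oplus> z \<in> T}"
      using inv(1)[OF k(2)] T(1) by (rule openin_left_translation)
    have 2: "K \<subseteq> {z \<in> ?G. \<ominus> k \<oplus> z \<in> T}" using T(2) KG by auto
    obtain V where V: "V \<in> \<V>" "V \<subseteq> {z \<in> ?G. \<ominus> k \<oplus> z \<in> T}"
      using \<V>(3)[OF 1 2] by (elim bexE)
    have "V \<in> range (from_nat_into \<V>)" unfolding range by (rule V(1))
    then obtain n where "V = from_nat_into \<V> n" by (rule rangeE)
    then have n: "from_nat_into \<V> n \<subseteq> {z \<in> ?G. \<ominus> k \<oplus> z \<in> T}" using V(2) by simp
    have "W n \<subseteq> T"
    proof
      fix z assume "z \<in> W n"
      then have "z \<in> ?G" "\<ominus> k \<oplus> (k \<oplus> z) \<in> T" using n unfolding W_def by auto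
      then show "z \<in> T" using k by (simp add: inv_add_cancel)
    qed
    then show "\<exists>n. W n \<subseteq> T" ..
  qed
qed

text \<open>H is the intersection of the \<open>U n\<close>. Closure under sums and inverses and
  invariance under gyrations pass to the intersection, and \<open>d x y\<close> vanishes exactly
  when \<open>\<ominus> x \<oplus> y\<close> lies in it.\<close>

lemma feathered_imp_metrizable_quotient:
  assumes Hausdorff: "Hausdorff_space X" and "feathered X"
  obtains H where "L_subgyrogroup (topspace X) (\<oplus>) gyr H" "compactin X H"
    "metrizable_space (coset_space X (\<oplus>) H)"
proof -
  let ?G = "topspace X"
  obtain K W where K: "compactin X K" "\<zero> \<in> K" and W: "\<And>n::nat. openin X (W n)" "\<And>n. K \<subseteq> W n"
    and K_base: "\<And>T. \<lbrakk>openin X T; K \<subseteq> T\<rbrakk> \<Longrightarrow> \<exists>n. W n \<subseteq> T"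
    by (rule feathered_at_zero[OF \<open>feathered X\<close>], rule that)
  obtain U where U: "\<And>n. gyr_nbhd (U n)" "\<And>n. U n \<subseteq> W n"
    and U3: "\<And>n a b c. \<lbrakk>a \<in> U (Suc n); b \<in> U (Suc n); c \<in> U (Suc n)\<rbrakk> \<Longrightarrow> (a \<oplus> b) \<oplus> c \<in> U n"
    by (rule gyr_nbhd_sequence[of W, OF W(1) subsetD[OF W(2) K(2)]], rule that)
  obtain d :: "'a \<Rightarrow> 'a \<Rightarrow> real" where d: "\<And>x y. 0 \<le> d x y" "\<And>x. d x x = 0" "\<And>x y. d x y = d y x"
    "\<And>x y z. d x z \<le> d x y + d y z"
    and dU: "\<And>n x y. \<lbrakk>x \<in> ?G; y \<in> ?G; \<ominus> x \<oplus> y \<in> U n\<rbrakk> \<Longrightarrow> d x y \<le> (1/2) ^ Suc n"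
    and Ud: "\<And>n x y. \<lbrakk>x \<in> ?G; y \<in> ?G; d x y < (1/2) ^ Suc n\<rbrakk> \<Longrightarrow> \<ominus> x \<oplus> y \<in> U n"
    and cont: "\<And>x. x \<in> ?G \<Longrightarrow> continuous_map X euclideanreal (d x)"
    by (rule gyr_nbhd_pseudometric[OF U(1) U3], assumption+, rule that)
  have UG: "U n \<subseteq> ?G" for n using U(1)[of n] unfolding gyr_nbhd_def by blast
  have zU: "\<zero> \<in> U n" for n using gyr_nbhd_zero[OF U(1)] .
  have U_Suc: "U (Suc n) \<subseteq> U n" for n
  proof
    fix a assume a: "a \<in> U (Suc n)"
    then show "a \<in> U n" using U3[OF a zU zU] UG[of "Suc n"] by (auto simp: zero subset_iff)
  qed
  have U_mono: "U n \<subseteq> U m" if "m \<le> n" for m n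
    using lift_Suc_antimono_le[of U, OF U_Suc that] .
  have U_add: "a \<oplus> b \<in> U n" if "a \<in> U (Suc n)" "b \<in> U (Suc n)" for a b n
    using U3[OF that zU] UG[of "Suc n"] that by (simp add: zero closed subset_iff)
  define H where "H = (\<Inter>n. U n)"
  have HG: "H \<subseteq> ?G" using UG[of 0] unfolding H_def by blast
  have d0: "d x y = 0 \<longleftrightarrow> \<ominus> x \<oplus> y \<in> H" if "x \<in> ?G" "y \<in> ?G" for x y
  proof
    assume "d x y = 0"
    then show "\<ominus> x \<oplus> y \<in> H" unfolding H_def using Ud[OF that] by auto
  next
    assume "\<ominus> x \<oplus> y \<in> H"
    then have le: "d x y \<le> (1/2) ^ Suc n" for n
      using dU[OF that, of n] unfolding H_def by blast
    show "d x y = 0"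
    proof (rule ccontr)
      assume "d x y \<noteq> 0"
      then have "0 < d x y" using d(1)[of x y] by simp
      then obtain n where "(1/2) ^ n < d x y" using real_arch_pow_inv[of "d x y" "1/2"] by auto
      moreover have "(1/2::real) ^ Suc n \<le> (1/2) ^ n" by simp
      ultimately show False using le[of n] by linarith
    qed
  qed
  have H_d: "h \<in> H \<longleftrightarrow> d \<zero> h = 0" if "h \<in> ?G" for h
    using d0[OF zero(1) that] that by (simp add: inv_zero zero)
  have LH: "L_subgyrogroup ?G (\<oplus>) gyr H"
  proof (rule L_subgyrogroupI[OF HG])
    show "\<zero> \<in> H" unfolding H_def using zU by blast
    show "\<ominus> h \<in> H" if "h \<in> H" for h
      using that U(1) unfolding H_def gyr_nbhd_def by blast
    show "h \<oplus> k \<in> H" if "h \<in> H" "k \<in> H" for h k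
      using that U_add unfolding H_def by blast
    show "gyr x y ` H = H" if "x \<in> ?G" "y \<in> ?G" for x y
    proof -
      have iff: "gyr x y z \<in> H \<longleftrightarrow> z \<in> H" if "z \<in> ?G" for z
        using U(1) \<open>x \<in> ?G\<close> \<open>y \<in> ?G\<close> that unfolding H_def gyr_nbhd_def by blast
      have "H \<subseteq> gyr x y ` H"
      proof
        fix h assume h: "h \<in> H"
        then have "h \<in> gyr x y ` ?G" using gyr_bij[OF that] HG unfolding bij_betw_def by blast
        then show "h \<in> gyr x y ` H" using h iff by blast
      qed
      then show ?thesis using iff HG by blast
    qed
  qed
  \<comment> \<open>A point \<open>h\<close> of H outside \<open>K\<close> would leave
    \<open>?G - {h}\<close> as an open set around \<open>K\<close>, which contains some
    \<open>W n\<close> and with it H.\<close>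
  have "H \<subseteq> K"
  proof
    fix h assume h: "h \<in> H"
    show "h \<in> K"
    proof (rule ccontr)
      assume "h \<notin> K"
      then have "K \<subseteq> ?G - {h}" using compactin_subset_topspace[OF K(1)] by blast
      moreover have "openin X (?G - {h})"
        using Hausdorff h HG by (intro openin_diff openin_topspace closedin_Hausdorff_singleton) auto
      ultimately obtain n where "W n \<subseteq> ?G - {h}" using K_base by blast
      then show False using h U(2)[of n] unfolding H_def by blast
    qed
  qed
  moreover have "closedin X H"
  proof -
    have "closedin X {h \<in> ?G. d \<zero> h \<in> {0}}"
      by (rule closedin_continuous_map_preimage[OF cont[OF zero(1)]]) simp
    also have "{h \<in> ?G. d \<zero> h \<in> {0}} = H" using H_d HG by auto
    finally show ?thesis .
  qed
  ultimately have compact: "compactin X H" using K(1) closed_compactin by blast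
  \<comment> \<open>The distance from \<open>\<zero>\<close> is positive on the compact set
    \<open>K - T\<close>, so it exceeds some \<open>(1/2) ^ N\<close> there. Hence \<open>K\<close>,
    and then some \<open>W m\<close>, lies in \<open>T \<union> P N\<close>; since
    \<open>U N\<close> avoids \<open>P N\<close>, the smaller of \<open>U m\<close> and
    \<open>U N\<close> lies in \<open>T\<close>.\<close>
  have U_base: "\<exists>n. U n \<subseteq> T" if T: "openin X T" "H \<subseteq> T" for T
  proof -
    define P where "P n = {x \<in> ?G. d \<zero> x \<in> {(1/2)^n<..}}" for n :: nat
    have P: "openin X (P n)" for n
      unfolding P_def by (rule openin_continuous_map_preimage[OF cont[OF zero(1)]]) simp
    have "closedin X (?G - T)" using closedin_diff[OF closedin_topspace T(1)] .
    then have "compactin X ((?G - T) \<inter> K)" using K(1) by (rule closed_Int_compactin)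
    moreover have "(?G - T) \<inter> K \<subseteq> \<Union>(range P)"
    proof
      fix x assume x: "x \<in> (?G - T) \<inter> K"
      then have "0 < d \<zero> x" using H_d[of x] T(2) d(1)[of \<zero> x] by force
      then obtain n where "(1/2) ^ n < d \<zero> x" using real_arch_pow_inv[of "d \<zero> x" "1/2"] by auto
      then show "x \<in> \<Union>(range P)" using x unfolding P_def by blast
    qed
    ultimately obtain \<F> where \<F>: "finite \<F>" "\<F> \<subseteq> range P" "(?G - T) \<inter> K \<subseteq> \<Union>\<F>"
      using compactinD[of X _ "range P"] P by (metis (no_types, lifting) rangeE)
    then obtain I where I: "finite I" "\<F> = P ` I" using finite_subset_image[OF \<F>(1,2)] by blast
    obtain N where N: "I \<subseteq> {..N}" using finite_nat_iff_bounded_le[of I] I(1) by blast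
    have "P n \<subseteq> P N" if "n \<le> N" for n
    proof
      fix x assume "x \<in> P n"
      then have "x \<in> ?G" "(1/2) ^ n < d \<zero> x" unfolding P_def by blast+
      moreover have "(1/2::real) ^ N \<le> (1/2) ^ n" using that by (intro power_decreasing) auto
      ultimately have "(1/2) ^ N < d \<zero> x" by linarith
      then show "x \<in> P N" using \<open>x \<in> ?G\<close> unfolding P_def by blast
    qed
    then have "\<Union>\<F> \<subseteq> P N" unfolding I(2) using N by blast
    then have "K \<subseteq> T \<union> P N" using \<F>(3) compactin_subset_topspace[OF K(1)] by blast
    moreover have "openin X (T \<union> P N)" using T(1) P by (rule openin_Un)
    ultimately obtain m where m: "W m \<subseteq> T \<union> P N" using K_base by blast
    have "U (max m N) \<subseteq> T"
    proof
      fix z assume z: "z \<in> U (max m N)"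
      then have zG: "z \<in> ?G" and "z \<in> U m" "z \<in> U N"
        using subsetD[OF UG z] subsetD[OF U_mono[of m "max m N"] z] subsetD[OF U_mono[of N "max m N"] z]
        by auto
      have "d \<zero> z \<le> (1/2) ^ Suc N"
        using dU[OF zero(1) zG, of N] \<open>z \<in> U N\<close> zG by (simp add: inv_zero zero)
      also have "\<dots> \<le> (1/2) ^ N" by simp
      finally have "z \<notin> P N" unfolding P_def by auto
      then show "z \<in> T" using m U(2)[of m] \<open>z \<in> U m\<close> by blast
    qed
    then show ?thesis by blast
  qed
  have base: "\<exists>e>0. \<forall>x\<in>?G. \<forall>y\<in>?G. d x y < e \<longrightarrow> \<ominus> x \<oplus> y \<in> T" if T: "openin X T" "H \<subseteq> T" for T
  proof -
    obtain n where "U n \<subseteq> T" using U_base[OF T] by blast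
    then show ?thesis using Ud[of _ _ n] by (intro exI[of _ "(1/2) ^ Suc n"]) auto
  qed
  have "metrizable_space (coset_space X (\<oplus>) H)"
    by (rule metrizable_coset_space[of d, OF d cont LH d0 base])
  then show thesis using LH compact by (rule that[rotated 2])
qed

end

theorem theorem3p20:
  fixes X :: "'a topology"
    and add :: "'a \<Rightarrow> 'a \<Rightarrow> 'a"
    and gyr :: "'a \<Rightarrow> 'a \<Rightarrow> 'a \<Rightarrow> 'a"
  assumes "strongly_topological_gyrogroup X add gyr"
    and "Hausdorff_space X"
    and "feathered X"
  shows "((\<exists>K. compact_resolution X K \<and> swallows_compact_sets X K) \<longleftrightarrow>
          (\<exists>H. L_subgyrogroup (topspace X) add gyr H \<and> compactin X H \<and>
               Polish_space (coset_space X add H))) \<and>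
         ((\<exists>K. compact_resolution X K \<and> swallows_compact_sets X K) \<longrightarrow>
          Cech_complete_space X)"
proof -
  interpret strongly_topological_gyrogroup X add gyr by (fact assms(1))
  let ?A = "\<exists>K. compact_resolution X K \<and> swallows_compact_sets X K"
  let ?B = "\<exists>H. L_subgyrogroup (topspace X) add gyr H \<and> compactin X H \<and>
      Polish_space (coset_space X add H)"
  have continuous: "continuous_map X (coset_space X add H) (left_coset add H)" for H
    by (rule quotient_imp_continuous_map[OF quotient_map_coset_space])
  have AB: ?B if ?A
  proof -
    obtain K where K: "compact_resolution X K" "swallows_compact_sets X K" using \<open>?A\<close> by blast
    obtain H where H: "L_subgyrogroup (topspace X) add gyr H" "compactin X H"
      "metrizable_space (coset_space X add H)"
      by (rule feathered_imp_metrizable_quotient[OF assms(2,3)])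
    have "left_coset add H ` topspace X = topspace (coset_space X add H)"
      by (simp add: topspace_coset_space)
    note compact_resolution_image[OF proper_map_left_coset[OF H(1,2)] continuous this K]
    then have "Polish_space (coset_space X add H)" by (rule Christensen[OF H(3)])
    then show ?B using H by blast
  qed
  moreover have ?A if ?B
  proof -
    obtain H where H: "L_subgyrogroup (topspace X) add gyr H" "compactin X H"
      "Polish_space (coset_space X add H)" using \<open>?B\<close> by blast
    obtain K where "compact_resolution (coset_space X add H) K"
      "swallows_compact_sets (coset_space X add H) K"
      by (rule Polish_space_resolution[OF H(3)])
    note compact_resolution_preimage[OF proper_map_left_coset[OF H(1,2)] continuous this]
    then show ?A by blast
  qed
  \<comment> \<open>The route leads through (2): the Polish quotient supplies completeness, and the
    projection pulls it back.\<close>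
  moreover have "Cech_complete_space X" if ?A
  proof -
    obtain H where H: "L_subgyrogroup (topspace X) add gyr H" "compactin X H"
      "Polish_space (coset_space X add H)" using AB[OF \<open>?A\<close>] by blast
    show ?thesis
      by (rule Cech_complete_space_proper_map[OF completely_regular_space assms(2)
            proper_map_left_coset[OF H(1,2)] continuous])
        (use H(3) in \<open>simp add: Polish_space_def\<close>)
  qed
  ultimately show ?thesis by blast
qed

end
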